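(* There exists a numerical (universal) constant $L_1>0$ such that the following holds. Let $X_1,\dots,X_n$ be independent $\mathcal{X}$-valued random variables, let $k:\mathcal{X}\times\mathcal{X}\to\mathbb{R}$ be a positive semidefinite kernel with separable reproducing kernel Hilbert space $\mathcal{H}$, and assume that there is $M\in(0,+\infty)$ such that $k(X_i,X_i)\le M^2$ almost surely for every $i\in\{1,\dots,n\}$. Let $C\ge 0$ be a constant and let $\mathrm{pen}:\mathcal{T}_n\to\mathbb{R}$ be a (deterministic) penalty function satisfying $$\forall\tau\in\mathcal{T}_n,\qquad \mathrm{pen}(\tau)\ge\frac{CM^2}{n}\left[\log\binom{n-1}{D_\tau-1}+D_\tau\right].$$ If $C\ge L_1$, then for every $y\ge 0$ there exists an event of probability at least $1-e^{-y}$ on which, for every $$\widehat\tau\in\operatorname*{argmin}_{\tau\in\mathcal{T}_n}\left\{\widehat{\mathcal{R}}_n(\tau)+\mathrm{pen}(\tau)\right\},$$ we have $$\mathcal{R}(\widehat\mu_{\widehat\tau})\le 2\inf_{\tau\in\mathcal{T}_n}\left\{\mathcal{R}(\widehat\mu_\tau)+\mathrm{pen}(\tau)\right\}+\frac{83\,y\,M^2}{n}.$$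
   Context: $\mathcal{X}$ is a measurable set and $n\ge 1$ an integer. A positive semidefinite kernel is a measurable function $k:\mathcal{X}\times\mathcal{X}\to\mathbb{R}$ such that for any $x_1,\dots,x_n\in\mathcal{X}$ the matrix $(k(x_i,x_j))_{1\le i,j\le n}$ is (symmetric) positive semidefinite. $\mathcal{H}$ is the reproducing kernel Hilbert space of $k$, assumed separable throughout, with inner product $\langle\cdot,\cdot\rangle_{\mathcal{H}}$ and norm $\|\cdot\|_{\mathcal{H}}$; $\Phi:\mathcal{X}\to\mathcal{H}$, $\Phi(x)=k(x,\cdot)$ is the canonical feature map. Set $Y_i=\Phi(X_i)\in\mathcal{H}$, $Y=(Y_1,\dots,Y_n)\in\mathcal{H}^n$. Let $\mu^\star_i\in\mathcal{H}$ be the (Bochner) mean of $Y_i$, characterized by $\langle\mu^\star_i,g\rangle_{\mathcal{H}}=\mathbb{E}[\langle Y_i,g\rangle_{\mathcal{H}}]$ for all $g\in\mathcal{H}$ (it exists under the boundedness assumption), and $\mu^\star=(\mu^\star_1,\dots,\mu^\star_n)\in\mathcal{H}^n$. For $D\in\{1,\dots,n\}$, $\mathcal{T}_n^D$ is the set of integer sequences $\tau=(\tau_0,\dots,\tau_D)$ with $0=\tau_0<\tau_1<\dots<\tau_D=n$; such a $\tau$ is a segmentation with $D_\tau:=D$ segments; $\mathcal{T}_n=\bigcup_{D=1}^n\mathcal{T}_n^D$. For $\tau\in\mathcal{T}_n$, $$F_\tau=\{f=(f_1,\dots,f_n)\in\mathcal{H}^n:\ f_{\tau_{\ell-1}+1}=\dots=f_{\tau_\ell}\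 \text{ for all } 1\le\ell\le D_\tau\}.$$ $\mathcal{H}^n$ carries the inner product $\langle f,g\rangle=\sum_{i=1}^n\langle f_i,g_i\rangle_{\mathcal{H}}$ with norm $\|\cdot\|$, $\Pi_\tau$ is the orthogonal projection of $\mathcal{H}^n$ onto $F_\tau$, and $\widehat\mu_\tau=\Pi_\tau Y$. The empirical risk (kernel least-squares criterion) of $\tau\in\mathcal{T}_n$ is $$\widehat{\mathcal{R}}_n(\tau)=\frac1n\sum_{i=1}^n k(X_i,X_i)-\frac1n\sum_{\ell=1}^{D_\tau}\left[\frac{1}{\tau_\ell-\tau_{\ell-1}}\sum_{i=\tau_{\ell-1}+1}^{\tau_\ell}\sum_{j=\tau_{\ell-1}+1}^{\tau_\ell}k(X_i,X_j)\right],$$ which equals $\frac1n\|Y-\widehat\mu_\tau\|^2$. The quadratic risk of $\mu\in\mathcal{H}^n$ is $\mathcal{R}(\mu)=\frac1n\|\mu-\mu^\star\|^2=\frac1n\sum_{i=1}^n\|\mu_i-\mu_i^\star\|_{\mathcal{H}}^2$. *)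

theory Defs
  imports "HOL-Probability.Probability"
begin

definition psd_kernel :: "'a measure \<Rightarrow> ('a \<Rightarrow> 'a \<Rightarrow> real) \<Rightarrow> bool" where
  "psd_kernel S k \<longleftrightarrow>
     (\<lambda>(x, y). k x y) \<in> borel_measurable (S \<Otimes>\<^sub>M S) \<and>
     (\<forall>x\<in>space S. \<forall>y\<in>space S. k x y = k y x) \<and>
     (\<forall>(m::nat) x (c :: nat \<Rightarrow> real). (\<forall>i\<in>{1..m}. x i \<in> space S) \<longrightarrow>
        0 \<le> (\<Sum>i=1..m. \<Sum>j=1..m. c i * c j * k (x i) (x j)))"

text \<open>
  A reproducing kernel Hilbert space on \<open>A\<close> is a Hilbert space whose elements are real functions
  on \<open>A\<close>. Here the Hilbert space is a type, and \<open>eval_at f x\<close> is the value at \<open>x\<close> of the function that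
  the vector \<open>f\<close> is; \<open>eval_at\<close> is linear, and vectors with the same values on \<open>A\<close> are equal.
\<close>

definition is_RKHS ::
  "'a set \<Rightarrow> ('a \<Rightarrow> 'a \<Rightarrow> real) \<Rightarrow> ('h::{real_inner, banach} \<Rightarrow> 'a \<Rightarrow> real) \<Rightarrow> bool" where
  "is_RKHS A k eval_at \<longleftrightarrow>
     (\<forall>f g. \<forall>x\<in>A. eval_at (f + g) x = eval_at f x + eval_at g x) \<and>
     (\<forall>c f. \<forall>x\<in>A. eval_at (c *\<^sub>R f) x = c * eval_at f x) \<and>
     (\<forall>f g. (\<forall>x\<in>A. eval_at f x = eval_at g x) \<longrightarrow> f = g) \<and>
     (\<forall>x\<in>A. \<exists>h. (\<forall>y\<in>A. eval_at h y = k x y) \<and> (\<forall>f. eval_at f x = f \<bullet> h))"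

definition feature_map ::
  "'a set \<Rightarrow> ('a \<Rightarrow> 'a \<Rightarrow> real) \<Rightarrow> ('h \<Rightarrow> 'a \<Rightarrow> real) \<Rightarrow> 'a \<Rightarrow> 'h" where
  "feature_map A k eval_at x = (THE h. \<forall>y\<in>A. eval_at h y = k x y)"

text \<open>
  A segmentation is the list \<open>[\<tau>\<^sub>0, \<dots>, \<tau>\<^sub>D]\<close>, so it has one segment less than its length.
\<close>

definition segmentations_of :: "nat \<Rightarrow> nat \<Rightarrow> nat list set" where
  "segmentations_of n D =
     {\<tau>. length \<tau> = D + 1 \<and> \<tau> ! 0 = 0 \<and> \<tau> ! D = n \<and> (\<forall>l<D. \<tau> ! l < \<tau> ! (l + 1))}"

definition segmentations :: "nat \<Rightarrow> nat list set" where
  "segmentations n = (\<Union>D\<in>{1..n}. segmentations_of n D)"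

definition nsegs :: "nat list \<Rightarrow> nat" where
  "nsegs \<tau> = length \<tau> - 1"

definition segment :: "nat list \<Rightarrow> nat \<Rightarrow> nat set" where
  "segment \<tau> l = {\<tau> ! (l - 1) + 1..\<tau> ! l}"

text \<open>
  Elements of the \<open>n\<close>-fold power of \<open>'h\<close> are the functions on \<open>{1..n}\<close>, made unique by
  \<^const>\<open>undefined\<close> elsewhere.
\<close>

definition seg_space :: "nat \<Rightarrow> nat list \<Rightarrow> (nat \<Rightarrow> 'h) set" where
  "seg_space n \<tau> =
     {f \<in> {1..n} \<rightarrow>\<^sub>E UNIV.
        \<forall>l\<in>{1..nsegs \<tau>}. \<forall>i\<in>segment \<tau> l. \<forall>j\<in>segment \<tau> l. f i = f j}"

definition inner_pow :: "nat \<Rightarrow> (nat \<Rightarrow> 'h::real_inner) \<Rightarrow> (nat \<Rightarrow> 'h) \<Rightarrow> real" where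
  "inner_pow n f g = (\<Sum>i=1..n. f i \<bullet> g i)"

definition seg_proj :: "nat \<Rightarrow> nat list \<Rightarrow> (nat \<Rightarrow> 'h::real_inner) \<Rightarrow> nat \<Rightarrow> 'h" where
  "seg_proj n \<tau> f =
     (THE g. g \<in> seg_space n \<tau> \<and> (\<forall>h\<in>seg_space n \<tau>. inner_pow n (\<lambda>i. f i - g i) h = 0))"

definition emp_risk :: "('a \<Rightarrow> 'a \<Rightarrow> real) \<Rightarrow> nat \<Rightarrow> (nat \<Rightarrow> 'a) \<Rightarrow> nat list \<Rightarrow> real" where
  "emp_risk k n x \<tau> =
     1 / real n * (\<Sum>i=1..n. k (x i) (x i)) -
     1 / real n * (\<Sum>l=1..nsegs \<tau>.
        1 / (real (\<tau> ! l) - real (\<tau> ! (l - 1))) *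
        (\<Sum>i\<in>segment \<tau> l. \<Sum>j\<in>segment \<tau> l. k (x i) (x j)))"

definition quad_risk ::
  "nat \<Rightarrow> (nat \<Rightarrow> 'h::real_inner) \<Rightarrow> (nat \<Rightarrow> 'h) \<Rightarrow> real" where
  "quad_risk n \<mu>star \<mu> =
     1 / real n * (\<Sum>i=1..n. (norm (\<mu> i - \<mu>star i))\<^sup>2)"

end

theory Submission
  imports Defs
begin

text \<open>
  Write \<open>\<epsilon> = Y - \<mu>\<close> for the noise, \<open>\<Pi>\<close> for the projection onto the vectors that are constant on the
  segments of \<open>\<tau>\<close>, \<open>v = \<mu> - \<Pi> \<mu>\<close> for the bias, \<open>L = \<langle>v, \<epsilon>\<rangle>\<close> and \<open>Q = \<parallel>\<Pi> \<epsilon>\<parallel>\<^sup>2\<close>. Projecting is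
  averaging over segments, and Pythagoras gives, with \<open>R\<close> the quadratic risk of \<open>\<Pi> Y\<close>,

    \<open>n * R = \<parallel>v\<parallel>\<^sup>2 + Q\<close>   and   \<open>n * emp_risk = \<parallel>\<epsilon>\<parallel>\<^sup>2 + n * R + 2 * L - 2 * Q\<close>

  (\<open>quad_risk_eq\<close>, \<open>residual_eq\<close>). Since \<open>\<parallel>\<epsilon>\<parallel>\<^sup>2\<close> does not depend on \<open>\<tau>\<close>, comparing the penalized
  empirical risks of a minimizer and of any \<open>\<tau>\<close> compares their risks up to the terms
  \<open>2 * L - 2 * Q\<close>. The oracle inequality follows once, for all segmentations at once, these are at
  most a third of the risk plus the penalty plus a multiple of \<open>M\<^sup>2 * y\<close>
  (\<open>oracle_inequality_on_deviation_event\<close>).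

  The term \<open>L\<close> is a sum of independent centered real variables, and Hoeffding's lemma shows that it
  is sub-Gaussian with variance proxy \<open>M\<^sup>2 * \<parallel>v\<parallel>\<^sup>2\<close>. For \<open>Q\<close>, a sum over segments of
  \<open>\<parallel>\<Sum> \<epsilon>\<^sub>i\<parallel>\<^sup>2 / card\<close>, the exponential moment at rate \<open>1 / (4 * M\<^sup>2)\<close> is at most \<open>exp 2\<close> per
  segment: expanding \<open>\<parallel>w + \<epsilon>\<^sub>i\<parallel>\<^sup>2\<close> and applying Hoeffding's lemma to the cross term \<open>\<langle>w, \<epsilon>\<^sub>i\<rangle>\<close>
  allows the summands to be integrated out one at a time, while the rate in front of \<open>\<parallel>w\<parallel>\<^sup>2\<close> at
  most doubles (\<open>nn_integral_exp_sq_norm_sum_noise_rate_le\<close>). No property of the dimension enters.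

  There are at most \<open>n - 1 choose D - 1\<close> segmentations with \<open>D\<close> segments, so deviation levels
  \<open>y + ln (n - 1 choose D - 1) + 2 * D\<close> make a union bound work (\<open>uniform_deviation_event\<close>), and a
  penalty with \<open>C \<ge> 40\<close> absorbs them.
\<close>

section \<open>Exponential moments of sums of bounded independent vectors\<close>

context prob_space
begin

lemma integrable_bounded_vector:
  fixes Z :: "'a \<Rightarrow> 'h::{banach, second_countable_topology}"
  assumes "random_variable borel Z" "AE \<omega> in M. norm (Z \<omega>) \<le> b"
  shows "integrable M Z"
  using assms by (intro integrable_const_bound)

lemma nn_integral_exp_inner_centered_le:
  fixes Z :: "'a \<Rightarrow> 'h::{real_inner, banach, second_countable_topology}"
  assumes [measurable]: "random_variable borel Z"
    and bd: "AE \<omega> in M. norm (Z \<omega>) \<le> b"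
  shows "(\<integral>\<^sup>+\<omega>. ennreal (exp (w \<bullet> (Z \<omega> - expectation Z))) \<partial>M) \<le> ennreal (exp (b\<^sup>2 * (norm w)\<^sup>2 / 2))"
proof -
  have int: "integrable M Z"
    using assms by (rule integrable_bounded_vector)
  interpret interval_bounded_random_variable M "\<lambda>\<omega>. w \<bullet> Z \<omega>" "- (b * norm w)" "b * norm w"
  proof
    show "AE \<omega> in M. w \<bullet> Z \<omega> \<in> {- (b * norm w)..b * norm w}"
      using bd
    proof eventually_elim
      case (elim \<omega>)
      have "\<bar>w \<bullet> Z \<omega>\<bar> \<le> norm w * norm (Z \<omega>)"
        by (rule Cauchy_Schwarz_ineq2)
      also have "\<dots> \<le> norm w * b"
        using elim by (simp add: mult_left_mono)
      finally show ?case by (auto simp: mult.commute)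
    qed
  qed measurable
  have "(\<integral>\<^sup>+\<omega>. ennreal (exp (1 * (w \<bullet> Z \<omega> - expectation (\<lambda>\<omega>. w \<bullet> Z \<omega>)))) \<partial>M)
      \<le> ennreal (exp (1\<^sup>2 * (b * norm w - - (b * norm w))\<^sup>2 / 8))"
    using Hoeffdings_lemma_nn_integral[of 1] by simp
  moreover have "expectation (\<lambda>\<omega>. w \<bullet> Z \<omega>) = w \<bullet> expectation Z"
    using int by simp
  moreover have "1\<^sup>2 * (b * norm w - - (b * norm w))\<^sup>2 / 8 = b\<^sup>2 * (norm w)\<^sup>2 / 2"
    by (simp add: power2_eq_square algebra_simps)
  ultimately show ?thesis
    by (simp add: inner_diff_right)
qed

text \<open>
  Adding a vector of norm at most \<open>b\<close>, minus its mean, to a fixed \<open>w\<close> costs a constant factor and replaces the rate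
  \<open>a\<close> in \<open>exp (a * \<parallel>w\<parallel>\<^sup>2)\<close> by \<open>a + 2 * a\<^sup>2 * b\<^sup>2\<close>: expand the square and apply Hoeffding's lemma
  to the cross term. This is what keeps the bound independent of the dimension.
\<close>

lemma nn_integral_exp_sq_norm_shift_le:
  fixes Z :: "'a \<Rightarrow> 'h::{real_inner, banach, second_countable_topology}"
  assumes Z [measurable]: "random_variable borel Z"
    and bd: "AE \<omega> in M. norm (Z \<omega>) \<le> b" and "0 \<le> a"
  shows "(\<integral>\<^sup>+\<omega>. ennreal (exp (a * (norm (w + (Z \<omega> - expectation Z)))\<^sup>2)) \<partial>M)
    \<le> ennreal (exp (4 * a * b\<^sup>2)) * ennreal (exp ((a + 2 * a\<^sup>2 * b\<^sup>2) * (norm w)\<^sup>2))"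
proof -
  let ?m = "expectation Z"
  have int: "integrable M Z"
    using Z bd by (rule integrable_bounded_vector)
  have "norm ?m \<le> expectation (\<lambda>\<omega>. norm (Z \<omega>))"
    by (rule integral_norm_bound)
  also have "\<dots> \<le> expectation (\<lambda>_. b)"
    using int bd by (intro integral_mono_AE) auto
  finally have m: "norm ?m \<le> b"
    by (simp add: prob_space)
  have "(\<integral>\<^sup>+\<omega>. ennreal (exp (a * (norm (w + (Z \<omega> - ?m)))\<^sup>2)) \<partial>M)
    \<le> (\<integral>\<^sup>+\<omega>. ennreal (exp (a * (norm w)\<^sup>2 + 4 * a * b\<^sup>2)) *
          ennreal (exp ((2 * a) *\<^sub>R w \<bullet> (Z \<omega> - ?m))) \<partial>M)"
  proof (rule nn_integral_mono_AE, use bd in eventually_elim)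
    case (elim \<omega>)
    have "norm (Z \<omega> - ?m) \<le> 2 * b"
      using norm_triangle_ineq4[of "Z \<omega>" ?m] elim m by linarith
    then have "(norm (Z \<omega> - ?m))\<^sup>2 \<le> (2 * b)\<^sup>2"
      by (rule power_mono) simp
    then have "a * (norm (Z \<omega> - ?m))\<^sup>2 \<le> 4 * a * b\<^sup>2"
      using mult_left_mono[OF _ \<open>0 \<le> a\<close>] by fastforce
    moreover have "(norm (w + (Z \<omega> - ?m)))\<^sup>2
        = (norm w)\<^sup>2 + 2 * (w \<bullet> (Z \<omega> - ?m)) + (norm (Z \<omega> - ?m))\<^sup>2"
      unfolding power2_norm_eq_inner by (simp add: inner_add_left inner_add_right inner_commute)
    then have "a * (norm (w + (Z \<omega> - ?m)))\<^sup>2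
        = a * (norm w)\<^sup>2 + (2 * a) *\<^sub>R w \<bullet> (Z \<omega> - ?m) + a * (norm (Z \<omega> - ?m))\<^sup>2"
      by (simp only: distrib_left) simp
    ultimately have "a * (norm (w + (Z \<omega> - ?m)))\<^sup>2
        \<le> (a * (norm w)\<^sup>2 + 4 * a * b\<^sup>2) + (2 * a) *\<^sub>R w \<bullet> (Z \<omega> - ?m)"
      by linarith
    then show ?case
      by (simp flip: ennreal_mult exp_add)
  qed
  also have "\<dots> = ennreal (exp (a * (norm w)\<^sup>2 + 4 * a * b\<^sup>2)) *
      (\<integral>\<^sup>+\<omega>. ennreal (exp ((2 * a) *\<^sub>R w \<bullet> (Z \<omega> - ?m))) \<partial>M)"
    by (rule nn_integral_cmult) measurable
  also have "\<dots> \<le> ennreal (exp (a * (norm w)\<^sup>2 + 4 * a * b\<^sup>2)) *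
      ennreal (exp (b\<^sup>2 * (norm ((2 * a) *\<^sub>R w))\<^sup>2 / 2))"
    using Z bd by (intro mult_left_mono nn_integral_exp_inner_centered_le) auto
  also have "\<dots> = ennreal (exp (4 * a * b\<^sup>2)) * ennreal (exp ((a + 2 * a\<^sup>2 * b\<^sup>2) * (norm w)\<^sup>2))"
    using \<open>0 \<le> a\<close>
    by (simp add: power2_eq_square algebra_simps flip: ennreal_mult exp_add)
  finally show ?thesis .
qed

end

text \<open>A finite family of independent random vectors whose norms are almost surely at most \<open>b\<close>.\<close>

locale bounded_indep_vectors = prob_space +
  fixes Y :: "nat \<Rightarrow> 'a \<Rightarrow> 'h::{real_inner, banach, second_countable_topology}"
    and I :: "nat set" and b :: real
  assumes indep: "indep_vars (\<lambda>_. borel) Y I"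
    and finite_I: "finite I"
    and bounded_Y: "\<And>i. i \<in> I \<Longrightarrow> AE \<omega> in M. norm (Y i \<omega>) \<le> b"
    and b_pos: "0 < b"
begin

text \<open>The \<open>i\<close>-th vector minus its mean.\<close>

definition noise :: "nat \<Rightarrow> 'a \<Rightarrow> 'h" where
  "noise i \<omega> = Y i \<omega> - expectation (Y i)"

lemma measurable_Y: "i \<in> I \<Longrightarrow> random_variable borel (Y i)"
  using indep by (simp add: indep_vars_def)

lemma measurable_noise: "i \<in> I \<Longrightarrow> random_variable borel (noise i)"
  unfolding noise_def using measurable_Y by simp

lemma indep_noise: "indep_vars (\<lambda>_. borel) noise I"
  unfolding noise_def by (rule indep_vars_compose2[OF indep]) simp

lemma indep_noise_sum:
  assumes "insert j J \<subseteq> I" "j \<notin> J"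
  shows "indep_var borel (\<lambda>\<omega>. \<Sum>i\<in>J. noise i \<omega>) borel (noise j)"
proof -
  have "indep_var
    borel ((\<lambda>f. \<Sum>i\<in>J. f i) \<circ> (\<lambda>\<omega>. restrict (\<lambda>i. noise i \<omega>) J))
    borel ((\<lambda>f. f j) \<circ> (\<lambda>\<omega>. restrict (\<lambda>i. noise i \<omega>) {j}))"
    using assms by (intro indep_var_compose[OF indep_var_restrict[OF indep_noise]]) auto
  moreover have "((\<lambda>f. f j) \<circ> (\<lambda>\<omega>. restrict (\<lambda>i. noise i \<omega>) {j})) = noise j"
    by auto
  moreover have "((\<lambda>f. \<Sum>i\<in>J. f i) \<circ> (\<lambda>\<omega>. restrict (\<lambda>i. noise i \<omega>) J)) = (\<lambda>\<omega>. \<Sum>i\<in>J. noise i \<omega>)"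
    by auto
  ultimately show ?thesis by simp
qed

lemma nn_integral_exp_sum_inner_noise_le:
  "(\<integral>\<^sup>+\<omega>. ennreal (exp (\<Sum>i\<in>I. v i \<bullet> noise i \<omega>)) \<partial>M)
    \<le> ennreal (exp (b\<^sup>2 * (\<Sum>i\<in>I. (norm (v i))\<^sup>2) / 2))"
proof -
  have "(\<integral>\<^sup>+\<omega>. ennreal (exp (\<Sum>i\<in>I. v i \<bullet> noise i \<omega>)) \<partial>M)
      = (\<integral>\<^sup>+\<omega>. (\<Prod>i\<in>I. ennreal (exp (v i \<bullet> noise i \<omega>))) \<partial>M)"
    by (simp add: exp_sum finite_I prod_ennreal)
  also have "\<dots> = (\<Prod>i\<in>I. \<integral>\<^sup>+\<omega>. ennreal (exp (v i \<bullet> noise i \<omega>)) \<partial>M)"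
    by (intro indep_vars_nn_integral finite_I indep_vars_compose2[OF indep_noise]) auto
  also have "\<dots> \<le> (\<Prod>i\<in>I. ennreal (exp (b\<^sup>2 * (norm (v i))\<^sup>2 / 2)))"
    unfolding noise_def
    by (intro prod_mono_ennreal nn_integral_exp_inner_centered_le measurable_Y bounded_Y) auto
  also have "\<dots> = ennreal (exp (b\<^sup>2 * (\<Sum>i\<in>I. (norm (v i))\<^sup>2) / 2))"
    by (simp add: prod_ennreal exp_sum finite_I sum_distrib_left sum_divide_distrib)
  finally show ?thesis .
qed

text \<open>
  Summands are removed one at a time. The rate \<open>1 / (2 * b\<^sup>2 * m)\<close> is chosen so that one removal
  turns \<open>m\<close> into \<open>m - 1\<close>, because \<open>1 / m + 1 / m\<^sup>2 \<le> 1 / (m - 1)\<close>.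
\<close>

lemma nn_integral_exp_sq_norm_sum_noise_rate_le:
  assumes "J \<subseteq> I" "real (card J) < m"
  shows "(\<integral>\<^sup>+\<omega>. ennreal (exp (1 / (2 * b\<^sup>2 * m) * (norm (\<Sum>i\<in>J. noise i \<omega>))\<^sup>2)) \<partial>M)
    \<le> ennreal (exp (2 * real (card J) / (m - real (card J))))"
proof -
  have "finite J"
    using assms(1) finite_I by (rule finite_subset)
  then show ?thesis
    using assms
  proof (induction J arbitrary: m rule: finite_induct)
    case empty
    then show ?case by (simp add: emeasure_space_1)
  next
    case (insert j J)
    let ?c = "real (card J)"
    let ?W = "\<lambda>\<omega>. \<Sum>i\<in>J. noise i \<omega>"
    define a where "a = 1 / (2 * b\<^sup>2 * m)"
    have m: "?c + 1 < m" and "0 \<le> ?c"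
      using insert by simp_all
    then have m1: "1 < m"
      by linarith
    have a: "0 \<le> a"
      using m1 by (simp add: a_def)
    have j: "j \<in> I" and J: "J \<subseteq> I"
      using insert.prems by auto
    have [measurable]: "random_variable borel (noise j)" "random_variable borel (Y j)"
      using j by (simp_all add: measurable_noise measurable_Y)
    have [measurable]: "random_variable borel ?W"
      using J by (auto intro!: borel_measurable_sum measurable_noise)
    interpret D: prob_space "distr M borel (noise j)"
      by (rule prob_space_distr) measurable
    have ind: "distr M borel ?W \<Otimes>\<^sub>M distr M borel (noise j) = distr M (borel \<Otimes>\<^sub>M borel) (\<lambda>\<omega>. (?W \<omega>, noise j \<omega>))"
      using indep_noise_sum[of j J] insert unfolding indep_var_distribution_eq by blast
    have rate: "a + 2 * a\<^sup>2 * b\<^sup>2 \<le> 1 / (2 * b\<^sup>2 * (m - 1))"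
    proof -
      have "a + 2 * a\<^sup>2 * b\<^sup>2 = 1 / (2 * b\<^sup>2) * ((m + 1) / m\<^sup>2)"
        using b_pos m1 by (simp add: a_def field_simps power2_eq_square)
      also have "(m + 1) / m\<^sup>2 \<le> 1 / (m - 1)"
        using m1 by (simp add: divide_simps power2_eq_square algebra_simps)
      finally show ?thesis
        using b_pos by (simp add: divide_right_mono)
    qed
    have "(\<integral>\<^sup>+\<omega>. ennreal (exp (a * (norm (\<Sum>i\<in>insert j J. noise i \<omega>))\<^sup>2)) \<partial>M)
      = (\<integral>\<^sup>+\<omega>. ennreal (exp (a * (norm (?W \<omega> + noise j \<omega>))\<^sup>2)) \<partial>M)"
      using insert by (simp add: add.commute)
    also have "\<dots> = (\<integral>\<^sup>+(w, z). ennreal (exp (a * (norm (w + z))\<^sup>2))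
        \<partial>distr M (borel \<Otimes>\<^sub>M borel) (\<lambda>\<omega>. (?W \<omega>, noise j \<omega>)))"
      by (subst nn_integral_distr) (auto simp: case_prod_beta)
    also have "\<dots> = (\<integral>\<^sup>+w. \<integral>\<^sup>+z. ennreal (exp (a * (norm (w + z))\<^sup>2)) \<partial>distr M borel (noise j) \<partial>distr M borel ?W)"
      unfolding ind[symmetric] by (subst D.nn_integral_fst[symmetric]) auto
    also have "\<dots> = (\<integral>\<^sup>+\<omega>. \<integral>\<^sup>+z. ennreal (exp (a * (norm (?W \<omega> + z))\<^sup>2)) \<partial>distr M borel (noise j) \<partial>M)"
      by (subst nn_integral_distr) auto
    also have "\<dots> \<le> (\<integral>\<^sup>+\<omega>. ennreal (exp (4 * a * b\<^sup>2)) *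
        ennreal (exp (1 / (2 * b\<^sup>2 * (m - 1)) * (norm (?W \<omega>))\<^sup>2)) \<partial>M)"
    proof (rule nn_integral_mono)
      fix \<omega>
      have "(\<integral>\<^sup>+z. ennreal (exp (a * (norm (?W \<omega> + z))\<^sup>2)) \<partial>distr M borel (noise j))
          = (\<integral>\<^sup>+\<omega>'. ennreal (exp (a * (norm (?W \<omega> + (Y j \<omega>' - expectation (Y j))))\<^sup>2)) \<partial>M)"
        by (subst nn_integral_distr) (auto simp: noise_def)
      also have "\<dots> \<le> ennreal (exp (4 * a * b\<^sup>2)) *
          ennreal (exp ((a + 2 * a\<^sup>2 * b\<^sup>2) * (norm (?W \<omega>))\<^sup>2))"
        using j a by (intro nn_integral_exp_sq_norm_shift_le bounded_Y) auto
      also have "\<dots> \<le> ennreal (exp (4 * a * b\<^sup>2)) *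
          ennreal (exp (1 / (2 * b\<^sup>2 * (m - 1)) * (norm (?W \<omega>))\<^sup>2))"
        using mult_right_mono[OF rate zero_le_power2[of "norm (?W \<omega>)"]]
        by (intro mult_left_mono ennreal_leI) auto
      finally show "(\<integral>\<^sup>+z. ennreal (exp (a * (norm (?W \<omega> + z))\<^sup>2)) \<partial>distr M borel (noise j)) \<le> \<dots>" .
    qed
    also have "\<dots> = ennreal (exp (4 * a * b\<^sup>2)) *
        (\<integral>\<^sup>+\<omega>. ennreal (exp (1 / (2 * b\<^sup>2 * (m - 1)) * (norm (?W \<omega>))\<^sup>2)) \<partial>M)"
      by (rule nn_integral_cmult) measurable
    also have "\<dots> \<le> ennreal (exp (2 / m)) * ennreal (exp (2 * ?c / (m - 1 - ?c)))"
      using b_pos m J by (intro mult_mono insert.IH) (auto simp: a_def)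
    also have "\<dots> \<le> ennreal (exp (2 * real (card (insert j J)) / (m - real (card (insert j J)))))"
    proof -
      have "2 / m \<le> 2 / (m - 1 - ?c)"
        using m \<open>0 \<le> ?c\<close> by (intro divide_left_mono) auto
      then have "2 / m + 2 * ?c / (m - 1 - ?c) \<le> 2 * (?c + 1) / (m - 1 - ?c)"
        by (simp add: add_divide_distrib distrib_left)
      moreover have "real (card (insert j J)) = ?c + 1"
        using insert by simp
      moreover have "m - (?c + 1) = m - 1 - ?c"
        by simp
      ultimately show ?thesis
        by (simp only: exp_le_cancel_iff ennreal_le_iff exp_ge_zero flip: ennreal_mult exp_add)
    qed
    finally show ?case
      by (simp add: a_def)
  qed
qed

text \<open>The case \<open>m = 2 * card J\<close>.\<close>

lemma nn_integral_exp_sq_norm_sum_noise_le: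
  assumes "J \<subseteq> I" "J \<noteq> {}"
  shows "(\<integral>\<^sup>+\<omega>. ennreal (exp ((norm (\<Sum>i\<in>J. noise i \<omega>))\<^sup>2 / real (card J) / (4 * b\<^sup>2))) \<partial>M) \<le> ennreal (exp 2)"
proof -
  have "0 < card J"
    using assms finite_I by (metis card_gt_0_iff finite_subset)
  then show ?thesis
    using nn_integral_exp_sq_norm_sum_noise_rate_le[OF assms(1), of "2 * real (card J)"]
    by (simp add: field_simps)
qed

text \<open>Sums over disjoint blocks are independent, so the exponential moments multiply.\<close>

lemma nn_integral_exp_block_energy_le:
  assumes fin: "finite L" and B: "\<And>l. l \<in> L \<Longrightarrow> B l \<subseteq> I \<and> B l \<noteq> {}"
    and disj: "disjoint_family_on B L"
  shows "(\<integral>\<^sup>+\<omega>. ennreal (exp ((\<Sum>l\<in>L. (norm (\<Sum>i\<in>B l. noise i \<omega>))\<^sup>2 / real (card (B l))) / (4 * b\<^sup>2))) \<partial>M)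
    \<le> ennreal (exp (2 * real (card L)))"
proof -
  let ?g = "\<lambda>l f. ennreal (exp ((norm (\<Sum>i\<in>B l. f i))\<^sup>2 / real (card (B l)) / (4 * b\<^sup>2)))"
  have "indep_vars (\<lambda>_. borel) (\<lambda>l \<omega>. ?g l (restrict (\<lambda>i. noise i \<omega>) (B l))) L"
    by (rule indep_vars_compose2[OF indep_vars_restrict[OF indep_noise _ disj]]) (use B in auto)
  then have ind: "indep_vars (\<lambda>_. borel) (\<lambda>l \<omega>. ?g l (\<lambda>i. noise i \<omega>)) L"
    by (simp cong: sum.cong)
  have "(\<integral>\<^sup>+\<omega>. ennreal (exp ((\<Sum>l\<in>L. (norm (\<Sum>i\<in>B l. noise i \<omega>))\<^sup>2 / real (card (B l))) / (4 * b\<^sup>2))) \<partial>M)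
      = (\<integral>\<^sup>+\<omega>. (\<Prod>l\<in>L. ?g l (\<lambda>i. noise i \<omega>)) \<partial>M)"
    by (simp add: sum_divide_distrib exp_sum fin prod_ennreal)
  also have "\<dots> = (\<Prod>l\<in>L. \<integral>\<^sup>+\<omega>. ?g l (\<lambda>i. noise i \<omega>) \<partial>M)"
    by (rule indep_vars_nn_integral[OF fin ind]) simp
  also have "\<dots> \<le> (\<Prod>l\<in>L. ennreal (exp 2))"
    using B by (intro prod_mono_ennreal nn_integral_exp_sq_norm_sum_noise_le) auto
  also have "\<dots> = ennreal (exp (2 * real (card L)))"
    by (simp add: ennreal_power exp_of_nat_mult[symmetric] mult.commute)
  finally show ?thesis .
qed

end

text \<open>Chernoff's bound, for an exponential moment of the variable itself.\<close>

lemma (in prob_space) prob_ge_le_exp_if_exp_moment: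
  assumes [measurable]: "random_variable borel Z"
    and "(\<integral>\<^sup>+\<omega>. ennreal (exp (Z \<omega>)) \<partial>M) \<le> ennreal (exp c)"
  shows "prob {\<omega>\<in>space M. c + x \<le> Z \<omega>} \<le> exp (- x)"
proof -
  have "emeasure M {\<omega>\<in>space M. c + x \<le> Z \<omega>}
      \<le> ennreal (exp (- 1 * (c + x))) * (\<integral>\<^sup>+\<omega>. ennreal (exp (1 * Z \<omega>)) * indicator (space M) \<omega> \<partial>M)"
    by (rule Chernoff_ineq_nn_integral_ge) auto
  also have "(\<integral>\<^sup>+\<omega>. ennreal (exp (1 * Z \<omega>)) * indicator (space M) \<omega> \<partial>M) = (\<integral>\<^sup>+\<omega>. ennreal (exp (Z \<omega>)) \<partial>M)"
    by (intro nn_integral_cong) auto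
  also have "ennreal (exp (- 1 * (c + x))) * \<dots> \<le> ennreal (exp (- 1 * (c + x))) * ennreal (exp c)"
    by (intro mult_left_mono assms) auto
  also have "\<dots> = ennreal (exp (- x))"
    by (simp flip: ennreal_mult exp_add)
  finally show ?thesis
    by (simp add: emeasure_eq_measure)
qed

section \<open>Segmentations\<close>

lemma segmentations_of_nth_less:
  assumes "\<tau> \<in> segmentations_of n D" "i < j" "j \<le> D"
  shows "\<tau> ! i < \<tau> ! j"
  using assms(2,3)
proof (induction j rule: less_induct)
  case (less j)
  show ?case
  proof (cases "i = j - 1")
    case True
    then show ?thesis
      using assms(1) less.prems by (auto simp: segmentations_of_def dest: spec[of _ i])
  next
    case False
    then have "\<tau> ! i < \<tau> ! (j - 1)"
      using less by auto
    also have "\<tau> ! (j - 1) < \<tau> ! (j - 1 + 1)"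
    proof -
      have "j - 1 < D"
        using less.prems by simp
      then show ?thesis
        using assms(1) unfolding segmentations_of_def by blast
    qed
    finally show ?thesis
      using less.prems by simp
  qed
qed

lemma sorted_wrt_segmentations_of:
  "\<tau> \<in> segmentations_of n D \<Longrightarrow> sorted_wrt (<) \<tau>"
  by (auto simp: sorted_wrt_iff_nth_less segmentations_of_nth_less)
     (auto simp: segmentations_of_def intro!: segmentations_of_nth_less[of \<tau> n D])

lemma nsegs_segmentations_of: "\<tau> \<in> segmentations_of n D \<Longrightarrow> nsegs \<tau> = D"
  by (simp add: segmentations_of_def nsegs_def)

text \<open>A segmentation is determined by its \<open>D - 1\<close> inner breakpoints, which lie in \<open>{1..n-1}\<close>.\<close>

lemma
  assumes "1 \<le> D"
  shows finite_segmentations_of: "finite (segmentations_of n D)"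
    and card_segmentations_of_le: "card (segmentations_of n D) \<le> (n - 1) choose (D - 1)"
proof -
  let ?f = "\<lambda>\<tau>. set \<tau> - {0, n}" and ?A = "{B. B \<subseteq> {1..n-1} \<and> card B = D - 1}"
  have ends: "0 \<in> set \<tau>" "n \<in> set \<tau>" "0 < n" "set \<tau> \<subseteq> {0..n}" if "\<tau> \<in> segmentations_of n D" for \<tau>
  proof -
    have len: "length \<tau> = D + 1" "\<tau> ! 0 = 0" "\<tau> ! D = n"
      using that by (auto simp: segmentations_of_def)
    show "0 \<in> set \<tau>" "n \<in> set \<tau>"
      using len nth_mem[of 0 \<tau>] nth_mem[of D \<tau>] by auto
    show "0 < n"
      using segmentations_of_nth_less[OF that, of 0 D] assms len by auto
    have "\<tau> ! i \<le> n" if "i < D + 1" for i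
      using segmentations_of_nth_less[OF \<open>\<tau> \<in> _\<close>, of i D] that len by (cases "i = D") auto
    then show "set \<tau> \<subseteq> {0..n}"
      using len by (auto simp: in_set_conv_nth)
  qed
  have inj: "inj_on ?f (segmentations_of n D)"
  proof (rule inj_onI)
    fix \<sigma> \<tau> assume *: "\<sigma> \<in> segmentations_of n D" "\<tau> \<in> segmentations_of n D" "?f \<sigma> = ?f \<tau>"
    then have "set \<sigma> = set \<tau>"
      using ends[OF *(1)] ends[OF *(2)] by blast
    then show "\<sigma> = \<tau>"
      using sorted_wrt_segmentations_of[OF *(1)] sorted_wrt_segmentations_of[OF *(2)]
      by (simp add: strict_sorted_equal)
  qed
  have sub: "?f ` segmentations_of n D \<subseteq> ?A"
  proof (rule image_subsetI)
    fix \<tau> assume \<tau>: "\<tau> \<in> segmentations_of n D"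
    have "card (set \<tau>) = D + 1"
      using sorted_wrt_segmentations_of[OF \<tau>] \<tau>
      by (simp add: distinct_card strict_sorted_iff segmentations_of_def)
    then have "card (?f \<tau>) = D - 1"
      using ends[OF \<tau>] by (simp add: card_Diff_subset)
    moreover have "?f \<tau> \<subseteq> {1..n-1}"
    proof
      fix i assume "i \<in> ?f \<tau>"
      then have "i \<noteq> 0" "i \<noteq> n" "i \<le> n" 
        using ends(4)[OF \<tau>] by auto
      then show "i \<in> {1..n-1}" by simp
    qed
    ultimately show "?f \<tau> \<in> ?A" by simp
  qed
  have fin: "finite ?A"
    by (rule finite_subset[of _ "Pow {1..n-1}"]) auto
  show "finite (segmentations_of n D)"
    using inj sub fin by (meson finite_imageD finite_subset)
  have "card (segmentations_of n D) \<le> card ?A"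
    using inj sub fin by (rule card_inj_on_le)
  then show "card (segmentations_of n D) \<le> (n - 1) choose (D - 1)"
    by (simp add: n_subsets)
qed

lemma ln_choose_nsegs_nonneg:
  assumes "\<tau> \<in> segmentations n"
  shows "0 \<le> ln (real ((n - 1) choose (nsegs \<tau> - 1)))"
proof -
  have "nsegs \<tau> - 1 \<le> n - 1"
    using assms by (auto simp: segmentations_def nsegs_segmentations_of)
  then have "0 < (n - 1) choose (nsegs \<tau> - 1)"
    by (rule zero_less_binomial)
  then show ?thesis
    by (intro ln_ge_zero) linarith
qed

lemma finite_segmentations: "finite (segmentations n)"
  by (auto simp: segmentations_def intro!: finite_segmentations_of)

lemma segmentations_nonempty:
  assumes "1 \<le> n" shows "segmentations n \<noteq> {}"
proof -
  have "[0, n] \<in> segmentations_of n 1"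
    using assms by (auto simp: segmentations_of_def)
  then show ?thesis
    using assms by (auto simp: segmentations_def)
qed

lemma sum_quarter_power_le: "(\<Sum>D=1..n. (1/4::real) ^ D) \<le> 1 / 3"
proof -
  have "3 * (\<Sum>D=1..n. (1/4::real) ^ D) = 1 - (1/4) ^ n"
    by (induction n) auto
  moreover have "0 \<le> (1/4::real) ^ n" by simp
  ultimately show ?thesis by linarith
qed

text \<open>
  The segmentations with \<open>D\<close> segments contribute at most \<open>exp (-2 * D) \<le> (1/4) ^ D\<close> in total.
\<close>

lemma sum_segmentations_weight_le:
  "(\<Sum>\<tau>\<in>segmentations n. exp (- ln (real ((n - 1) choose (nsegs \<tau> - 1))) - 2 * real (nsegs \<tau>))) \<le> 1 / 3"
    (is "(\<Sum>\<tau>\<in>_. ?w (nsegs \<tau>)) \<le> _")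
proof -
  have "(\<Sum>\<tau>\<in>segmentations n. ?w (nsegs \<tau>)) = (\<Sum>D=1..n. \<Sum>\<tau>\<in>segmentations_of n D. ?w (nsegs \<tau>))"
    unfolding segmentations_def
    by (rule sum.UNION_disjoint) (auto simp: finite_segmentations_of dest!: nsegs_segmentations_of)
  also have "\<dots> = (\<Sum>D=1..n. real (card (segmentations_of n D)) * ?w D)"
    by (simp add: nsegs_segmentations_of)
  also have "\<dots> \<le> (\<Sum>D=1..n. (1/4) ^ D)"
  proof (rule sum_mono)
    fix D assume D: "D \<in> {1..n}"
    then have pos: "0 < (n - 1) choose (D - 1)"
      by auto
    have "(4::real) \<le> exp 1 * exp 1"
      using mult_mono[OF exp_ge_add_one_self[of 1] exp_ge_add_one_self[of 1]] by simp
    then have "(4::real) \<le> exp 2"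
      by (simp flip: exp_add)
    then have "exp (- 2) \<le> (1/4::real)"
      by (simp add: exp_minus field_simps)
    then have "exp (- 2) ^ D \<le> (1/4::real) ^ D"
      by (rule power_mono) simp
    then have e: "exp (- (2 * real D)) \<le> (1/4::real) ^ D"
      by (simp add: mult.commute flip: exp_of_nat_mult)
    have "real (card (segmentations_of n D)) * ?w D
        \<le> real ((n - 1) choose (D - 1)) * ?w D"
      using card_segmentations_of_le[of D n] D by (intro mult_right_mono) auto
    also have "\<dots> = exp (- (2 * real D))"
      using pos by (simp add: exp_diff exp_minus exp_add inverse_eq_divide)
    finally show "real (card (segmentations_of n D)) * ?w D \<le> (1/4) ^ D"
      using e by linarith
  qed
  also have "\<dots> \<le> 1 / 3"
    by (rule sum_quarter_power_le)
  finally show ?thesis .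
qed

lemma segment_partition:
  assumes "\<tau> \<in> segmentations n"
  shows Union_segment: "(\<Union>l\<in>{1..nsegs \<tau>}. segment \<tau> l) = {1..n}"
    and disjoint_segment: "disjoint_family_on (segment \<tau>) {1..nsegs \<tau>}"
    and segment_nonempty: "l \<in> {1..nsegs \<tau>} \<Longrightarrow> segment \<tau> l \<noteq> {}"
proof -
  obtain D where D: "\<tau> \<in> segmentations_of n D"
    using assms by (auto simp: segmentations_def)
  have [simp]: "nsegs \<tau> = D"
    using D by (rule nsegs_segmentations_of)
  have ends: "\<tau> ! 0 = 0" "\<tau> ! D = n"
    using D by (auto simp: segmentations_of_def)
  have less: "\<tau> ! i < \<tau> ! j" if "i < j" "j \<le> D" for i j
    using segmentations_of_nth_less[OF D that] .
  have le: "\<tau> ! i \<le> \<tau> ! j" if "i \<le> j" "j \<le> D" for i j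
    using less[of i j] that by (cases "i = j") auto
  have "(\<Union>l\<in>{1..d}. segment \<tau> l) = {1..\<tau> ! d}" if "d \<le> D" for d
    using that
  proof (induction d)
    case 0
    then show ?case by (simp add: ends)
  next
    case (Suc d)
    have "{1..Suc d} = insert (Suc d) {1..d}"
      by auto
    then show ?case
      using Suc less[of d "Suc d"] by (auto simp: segment_def)
  qed
  from this[of D] show "(\<Union>l\<in>{1..nsegs \<tau>}. segment \<tau> l) = {1..n}"
    by (simp add: ends)
  have "segment \<tau> l \<inter> segment \<tau> m = {}" if "1 \<le> l" "l < m" "m \<le> D" for l m
    using le[of l "m - 1"] that by (force simp: segment_def)
  then show "disjoint_family_on (segment \<tau>) {1..nsegs \<tau>}"
    unfolding disjoint_family_on_def by (metis Int_commute atLeastAtMost_iff \<open>nsegs \<tau> = D\<close> nat_neq_iff)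
  show "segment \<tau> l \<noteq> {}" if "l \<in> {1..nsegs \<tau>}"
    using less[of "l - 1" l] that by (auto simp: segment_def)
qed

lemma card_segment: "card (segment \<tau> l) = \<tau> ! l - \<tau> ! (l - 1)"
  by (simp add: segment_def)

lemma sum_over_segments:
  assumes "\<tau> \<in> segmentations n"
  shows "(\<Sum>i=1..n. f i) = (\<Sum>l=1..nsegs \<tau>. \<Sum>i\<in>segment \<tau> l. f i)"
  unfolding Union_segment[OF assms, symmetric] using disjoint_segment[OF assms]
  by (intro sum.UNION_disjoint) (auto simp: disjoint_family_on_def segment_def)

section \<open>Projection onto piecewise constant vectors\<close>

text \<open>The mean of \<open>f\<close> over \<open>B\<close>; it is \<open>0\<close> when \<open>B\<close> is empty or infinite.\<close>

definition mean_on :: "nat set \<Rightarrow> (nat \<Rightarrow> 'h::real_vector) \<Rightarrow> 'h" where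
  "mean_on B f = (\<Sum>i\<in>B. f i) /\<^sub>R real (card B)"

lemma card_scale_mean_on:
  assumes "finite B" "B \<noteq> {}"
  shows "real (card B) *\<^sub>R mean_on B f = (\<Sum>i\<in>B. f i)"
  using assms by (simp add: mean_on_def)

lemma mean_on_diff: "mean_on B (\<lambda>i. f i - g i) = mean_on B f - mean_on B g"
  by (simp add: mean_on_def sum_subtractf scaleR_diff_right)

lemma sum_minus_mean_on:
  assumes "finite B" "B \<noteq> {}"
  shows "(\<Sum>i\<in>B. f i - mean_on B f) = 0"
  using card_scale_mean_on[OF assms, of f] by (simp add: sum_subtractf sum_constant_scaleR)

text \<open>
  The proof also provides the existence and uniqueness behind the definite description in
  \<^const>\<open>seg_proj\<close>.
\<close>

lemma seg_proj_eq_mean_on: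
  fixes f :: "nat \<Rightarrow> 'h::real_inner"
  assumes \<tau>: "\<tau> \<in> segmentations n" and l: "l \<in> {1..nsegs \<tau>}" and i: "i \<in> segment \<tau> l"
  shows "seg_proj n \<tau> f i = mean_on (segment \<tau> l) f"
proof -
  define g where "g = (\<lambda>i\<in>{1..n}. mean_on (segment \<tau> (THE l. l \<in> {1..nsegs \<tau>} \<and> i \<in> segment \<tau> l)) f)"
  have g: "g i = mean_on (segment \<tau> l) f" if "l \<in> {1..nsegs \<tau>}" "i \<in> segment \<tau> l" for i l
  proof -
    have "(THE l. l \<in> {1..nsegs \<tau>} \<and> i \<in> segment \<tau> l) = l"
      using that disjoint_segment[OF \<tau>] unfolding disjoint_family_on_def by (intro the_equality) blast+
    moreover have "i \<in> {1..n}"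
      using Union_segment[OF \<tau>] that by blast
    ultimately show ?thesis
      by (simp add: g_def)
  qed
  have gF: "g \<in> seg_space n \<tau>"
    unfolding seg_space_def using g by (auto simp: g_def)
  have orth: "inner_pow n (\<lambda>i. f i - g i) h = 0" if h: "h \<in> seg_space n \<tau>" for h
  proof -
    have "inner_pow n (\<lambda>i. f i - g i) h = (\<Sum>l=1..nsegs \<tau>. \<Sum>i\<in>segment \<tau> l. (f i - g i) \<bullet> h i)"
      unfolding inner_pow_def by (rule sum_over_segments[OF \<tau>])
    also have "\<dots> = (\<Sum>l=1..nsegs \<tau>. 0)"
    proof (rule sum.cong[OF refl])
      fix l assume l: "l \<in> {1..nsegs \<tau>}"
      then obtain j where j: "j \<in> segment \<tau> l"
        using segment_nonempty[OF \<tau>] by blast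
      have "h i = h j" if "i \<in> segment \<tau> l" for i
        using h l j that unfolding seg_space_def by blast
      then have "(\<Sum>i\<in>segment \<tau> l. (f i - g i) \<bullet> h i) = (\<Sum>i\<in>segment \<tau> l. (f i - mean_on (segment \<tau> l) f) \<bullet> h j)"
        by (intro sum.cong refl arg_cong2[where f = inner] arg_cong2[where f = minus] g[OF l])
      also have "\<dots> = (\<Sum>i\<in>segment \<tau> l. f i - mean_on (segment \<tau> l) f) \<bullet> h j"
        by (simp only: inner_sum_left)
      also have "\<dots> = 0"
        using segment_nonempty[OF \<tau> l] by (subst sum_minus_mean_on) (auto simp: segment_def)
      finally show "(\<Sum>i\<in>segment \<tau> l. (f i - g i) \<bullet> h i) = 0" .
    qed
    finally show ?thesis by simp
  qed
  have "seg_proj n \<tau> f = g"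
    unfolding seg_proj_def
  proof (rule the_equality)
    fix g' assume g': "g' \<in> seg_space n \<tau> \<and> (\<forall>h\<in>seg_space n \<tau>. inner_pow n (\<lambda>i. f i - g' i) h = 0)"
    define d where "d = (\<lambda>i\<in>{1..n}. g i - g' i)"
    have seg_sub: "i \<in> segment \<tau> l \<Longrightarrow> i \<in> {1..n}" if "l \<in> {1..nsegs \<tau>}" for i l
      using Union_segment[OF \<tau>] that by blast
    have "d \<in> seg_space n \<tau>"
      unfolding seg_space_def
    proof (intro CollectI conjI ballI)
      show "d \<in> {1..n} \<rightarrow>\<^sub>E UNIV" by (simp add: d_def)
      fix l i j assume l: "l \<in> {1..nsegs \<tau>}" and ij: "i \<in> segment \<tau> l" "j \<in> segment \<tau> l"
      have "g i = g j" "g' i = g' j"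
        using gF g' l ij unfolding seg_space_def by blast+
      then show "d i = d j"
        using seg_sub[OF l] ij by (simp add: d_def)
    qed
    then have "inner_pow n (\<lambda>i. f i - g' i) d - inner_pow n (\<lambda>i. f i - g i) d = 0"
      using g' orth by simp
    then have "(\<Sum>i=1..n. (norm (g i - g' i))\<^sup>2) = 0"
      by (simp add: inner_pow_def d_def power2_norm_eq_inner algebra_simps flip: sum_subtractf)
    then have "\<forall>i\<in>{1..n}. g i = g' i"
      by (subst (asm) sum_nonneg_eq_0_iff) auto
    moreover have "g \<in> {1..n} \<rightarrow>\<^sub>E UNIV" "g' \<in> {1..n} \<rightarrow>\<^sub>E UNIV"
      using gF g' by (auto simp: seg_space_def)
    ultimately show "g' = g"
      by (metis PiE_ext)
  qed (use gF orth in blast)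
  then show ?thesis
    using g[OF l i] by simp
qed

text \<open>
  Both identities write \<open>y i = m i + e i\<close> on one segment; the deviations of \<open>m\<close> from its mean sum
  to zero, so they are orthogonal to constants.
\<close>

lemma
  fixes y m :: "nat \<Rightarrow> 'h::real_inner"
  assumes B: "finite B" "B \<noteq> {}"
  defines "e \<equiv> \<lambda>i. y i - m i" and "v \<equiv> \<lambda>i. m i - mean_on B m"
  shows sum_sq_mean_on_error:
      "(\<Sum>i\<in>B. (norm (mean_on B y - m i))\<^sup>2)
        = (\<Sum>i\<in>B. (norm (v i))\<^sup>2) + (norm (\<Sum>i\<in>B. e i))\<^sup>2 / real (card B)" (is ?error)
    and sum_sq_mean_on_residual:
      "(\<Sum>i\<in>B. y i \<bullet> y i) - 1 / real (card B) * (\<Sum>i\<in>B. \<Sum>j\<in>B. y i \<bullet> y j)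
        = (\<Sum>i\<in>B. (norm (e i))\<^sup>2) + (\<Sum>i\<in>B. (norm (mean_on B y - m i))\<^sup>2)
          + 2 * (\<Sum>i\<in>B. v i \<bullet> e i) - 2 * ((norm (\<Sum>i\<in>B. e i))\<^sup>2 / real (card B))" (is ?resid)
proof -
  define c where "c = real (card B)"
  define a where "a = mean_on B e"
  have c: "0 < c"
    using B by (simp add: c_def card_gt_0_iff)
  have sum_e: "(\<Sum>i\<in>B. e i) = c *\<^sub>R a"
    using card_scale_mean_on[OF B, of e] by (simp add: a_def c_def)
  have sum_v: "(\<Sum>i\<in>B. v i) = 0"
    unfolding v_def by (rule sum_minus_mean_on[OF B])
  have mean: "mean_on B y = mean_on B m + a"
    by (simp add: a_def e_def mean_on_diff)
  have sum_y: "(\<Sum>i\<in>B. y i) = c *\<^sub>R mean_on B y"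
    using card_scale_mean_on[OF B, of y] by (simp add: c_def)
  have energy: "(norm (\<Sum>i\<in>B. e i))\<^sup>2 / c = c * (a \<bullet> a)"
    unfolding sum_e power2_norm_eq_inner using c by simp
  have "(\<Sum>i\<in>B. (norm (mean_on B y - m i))\<^sup>2) = (\<Sum>i\<in>B. a \<bullet> a - 2 * (a \<bullet> v i) + (norm (v i))\<^sup>2)"
    by (rule sum.cong)
       (simp_all add: mean v_def power2_norm_eq_inner inner_add_left inner_add_right
          inner_diff_left inner_diff_right inner_commute algebra_simps)
  also have "\<dots> = c * (a \<bullet> a) - 2 * (a \<bullet> (\<Sum>i\<in>B. v i)) + (\<Sum>i\<in>B. (norm (v i))\<^sup>2)"
    by (simp add: sum.distrib sum_subtractf c_def inner_sum_right sum_distrib_left)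
  finally have error: "(\<Sum>i\<in>B. (norm (mean_on B y - m i))\<^sup>2) = c * (a \<bullet> a) + (\<Sum>i\<in>B. (norm (v i))\<^sup>2)"
    by (simp add: sum_v)
  then show ?error
    using energy by (simp add: c_def)
  have "(\<Sum>i\<in>B. y i \<bullet> y i) - 1 / c * (\<Sum>i\<in>B. \<Sum>j\<in>B. y i \<bullet> y j)
      = (\<Sum>i\<in>B. y i \<bullet> y i) - 1 / c * ((\<Sum>i\<in>B. y i) \<bullet> (\<Sum>j\<in>B. y j))"
    by (simp add: inner_sum_left inner_sum_right) (subst sum.swap, simp)
  also have "\<dots> = (\<Sum>i\<in>B. y i \<bullet> y i) - c * (mean_on B y \<bullet> mean_on B y)"
    using c by (simp add: sum_y)
  also have "\<dots> = (\<Sum>i\<in>B. (norm (y i - mean_on B y))\<^sup>2)"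
  proof -
    have "(\<Sum>i\<in>B. (norm (y i - mean_on B y))\<^sup>2)
        = (\<Sum>i\<in>B. y i \<bullet> y i) - 2 * ((\<Sum>i\<in>B. y i) \<bullet> mean_on B y) + c * (mean_on B y \<bullet> mean_on B y)"
      by (simp add: power2_norm_eq_inner inner_diff_left inner_diff_right inner_commute
          sum.distrib sum_subtractf c_def inner_sum_left inner_sum_right sum_distrib_left algebra_simps)
    then show ?thesis
      by (simp add: sum_y)
  qed
  also have "\<dots> = (\<Sum>i\<in>B. (norm (e i))\<^sup>2 + (norm (v i))\<^sup>2 + 2 * (v i \<bullet> e i) - 2 * (e i \<bullet> a) - 2 * (v i \<bullet> a) + a \<bullet> a)"
    by (rule sum.cong)
       (simp_all add: mean v_def e_def power2_norm_eq_inner inner_add_left inner_add_right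
          inner_diff_left inner_diff_right inner_commute algebra_simps)
  also have "\<dots> = (\<Sum>i\<in>B. (norm (e i))\<^sup>2) + (\<Sum>i\<in>B. (norm (v i))\<^sup>2) + 2 * (\<Sum>i\<in>B. v i \<bullet> e i)
      - 2 * ((\<Sum>i\<in>B. e i) \<bullet> a) - 2 * ((\<Sum>i\<in>B. v i) \<bullet> a) + c * (a \<bullet> a)"
    by (simp add: sum.distrib sum_subtractf c_def inner_sum_left sum_distrib_left)
  finally show ?resid
    unfolding error c_def[symmetric] energy by (simp add: sum_v sum_e)
qed

section \<open>The feature map\<close>

context
  fixes A :: "'a set" and k :: "'a \<Rightarrow> 'a \<Rightarrow> real"
    and eval_at :: "'h::{real_inner, banach} \<Rightarrow> 'a \<Rightarrow> real"
  assumes rkhs: "is_RKHS A k eval_at"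
begin

lemma feature_map_reproducing:
  assumes "x \<in> A"
  shows eval_at_feature_map: "y \<in> A \<Longrightarrow> eval_at (feature_map A k eval_at x) y = k x y"
    and eval_at_eq_inner: "eval_at f x = f \<bullet> feature_map A k eval_at x"
proof -
  obtain h where h: "\<forall>y\<in>A. eval_at h y = k x y" "\<forall>f. eval_at f x = f \<bullet> h"
    using rkhs assms unfolding is_RKHS_def by blast
  have "g = h" if "\<forall>y\<in>A. eval_at g y = k x y" for g
    using rkhs h(1) that unfolding is_RKHS_def by metis
  then have "feature_map A k eval_at x = h"
    unfolding feature_map_def using h(1) by (intro the_equality)
  then show "y \<in> A \<Longrightarrow> eval_at (feature_map A k eval_at x) y = k x y"
    and "eval_at f x = f \<bullet> feature_map A k eval_at x"
    using h by auto
qed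

lemma inner_feature_map:
  "x \<in> A \<Longrightarrow> y \<in> A \<Longrightarrow> feature_map A k eval_at x \<bullet> feature_map A k eval_at y = k x y"
  using eval_at_feature_map[of x y] eval_at_eq_inner[of y] by simp

end

text \<open>
  The distance between two feature vectors is a function of the kernel, so preimages of balls
  centered at feature vectors are measurable; as \<open>'h\<close> is second countable, countably many such
  balls cover the part of an open set that the feature map can reach.
\<close>

lemma measurable_feature_map:
  fixes eval_at :: "'h::{real_inner, banach, second_countable_topology} \<Rightarrow> 'a \<Rightarrow> real"
  assumes psd: "psd_kernel S k" and rkhs: "is_RKHS (space S) k eval_at"
  shows "feature_map (space S) k eval_at \<in> borel_measurable S"
proof (rule borel_measurableI)
  let ?\<Phi> = "feature_map (space S) k eval_at"
  have k [measurable]: "(\<lambda>(x, y). k x y) \<in> borel_measurable (S \<Otimes>\<^sub>M S)"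
    using psd by (simp add: psd_kernel_def)
  have ball: "?\<Phi> -` ball (?\<Phi> x) r \<inter> space S \<in> sets S" if x: "x \<in> space S" for x r
  proof -
    have "(dist (?\<Phi> x) (?\<Phi> y))\<^sup>2 = k x x - 2 * k x y + k y y" if "y \<in> space S" for y
      using x that
      by (simp add: dist_norm power2_norm_eq_inner inner_diff_left inner_diff_right
          inner_commute[of "?\<Phi> y" "?\<Phi> x"] inner_feature_map[OF rkhs])
    then have "dist (?\<Phi> x) (?\<Phi> y) = sqrt (k x x - 2 * k x y + k y y)" if "y \<in> space S" for y
      using that by (metis real_sqrt_unique zero_le_dist)
    then have "?\<Phi> -` ball (?\<Phi> x) r \<inter> space S = {y \<in> space S. sqrt (k x x - 2 * k x y + k y y) < r}"
      by auto
    also have "\<dots> \<in> sets S"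
    proof -
      have [measurable]: "(\<lambda>y. k x y) \<in> borel_measurable S" "(\<lambda>y. k y y) \<in> borel_measurable S"
        using measurable_compose[OF _ k, of "\<lambda>y. (x, y)" S] measurable_compose[OF _ k, of "\<lambda>y. (y, y)" S] x
        by auto
      show ?thesis by measurable
    qed
    finally show ?thesis .
  qed
  fix U :: "'h set" assume "open U"
  define \<F> where "\<F> = {ball (?\<Phi> x) r | x r. x \<in> space S \<and> ball (?\<Phi> x) r \<subseteq> U}"
  obtain \<G> where \<G>: "\<G> \<subseteq> \<F>" "countable \<G>" "\<Union>\<G> = \<Union>\<F>"
    using Lindelof[of \<F>] by (auto simp: \<F>_def)
  have "x \<in> ?\<Phi> -` \<Union>\<F>" if x: "x \<in> space S" "?\<Phi> x \<in> U" for x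
  proof -
    obtain r where "0 < r" "ball (?\<Phi> x) r \<subseteq> U"
      using \<open>open U\<close> x(2) openE by blast
    then have "ball (?\<Phi> x) r \<in> \<F>" "?\<Phi> x \<in> ball (?\<Phi> x) r"
      using x(1) by (auto simp: \<F>_def)
    then show ?thesis by blast
  qed
  moreover have "\<Union>\<F> \<subseteq> U"
    by (auto simp: \<F>_def)
  ultimately have "?\<Phi> -` U \<inter> space S = ?\<Phi> -` \<Union>\<F> \<inter> space S"
    by blast
  also have "\<dots> = (\<Union>G\<in>\<G>. ?\<Phi> -` G \<inter> space S)"
    unfolding \<G>(3)[symmetric] by blast
  also have "\<dots> \<in> sets S"
    using \<G>(1,2) ball by (intro sets.countable_UN') (auto simp: \<F>_def)
  finally show "?\<Phi> -` U \<inter> space S \<in> sets S" .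
qed

section \<open>Deviations over all segmentations\<close>

locale segmented_sample = bounded_indep_vectors M Y "{1..n}" b
  for M :: "'a measure" and Y :: "nat \<Rightarrow> 'a \<Rightarrow> 'h::{real_inner, banach, second_countable_topology}"
    and n :: nat and b :: real +
  assumes n_pos: "1 \<le> n"
begin

abbreviation mean_vec :: "nat \<Rightarrow> 'h" where
  "mean_vec i \<equiv> expectation (Y i)"

text \<open>The component of the mean vector orthogonal to the vectors constant on the segments of \<open>\<tau>\<close>.\<close>

definition bias :: "nat list \<Rightarrow> nat \<Rightarrow> 'h" where
  "bias \<tau> i = mean_vec i - seg_proj n \<tau> mean_vec i"

text \<open>The squared norm of the bias in the \<open>n\<close>-fold power.\<close>

definition sq_bias :: "nat list \<Rightarrow> real" where
  "sq_bias \<tau> = (\<Sum>i=1..n. (norm (bias \<tau> i))\<^sup>2)"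

text \<open>The inner product of bias and noise in the \<open>n\<close>-fold power.\<close>

definition bias_noise :: "nat list \<Rightarrow> 'a \<Rightarrow> real" where
  "bias_noise \<tau> \<omega> = (\<Sum>i=1..n. bias \<tau> i \<bullet> noise i \<omega>)"

text \<open>The squared norm of the projected noise, written out over the segments.\<close>

definition noise_energy :: "nat list \<Rightarrow> 'a \<Rightarrow> real" where
  "noise_energy \<tau> \<omega> =
     (\<Sum>l=1..nsegs \<tau>. (norm (\<Sum>i\<in>segment \<tau> l. noise i \<omega>))\<^sup>2 / real (card (segment \<tau> l)))"

lemma noise_energy_nonneg: "0 \<le> noise_energy \<tau> \<omega>"
  by (simp add: noise_energy_def sum_nonneg)

lemma segment_subset: "\<tau> \<in> segmentations n \<Longrightarrow> l \<in> {1..nsegs \<tau>} \<Longrightarrow> segment \<tau> l \<subseteq> {1..n}"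
  using Union_segment by blast

lemma measurable_bias_noise: "random_variable borel (bias_noise \<tau>)"
  unfolding bias_noise_def
  by (intro borel_measurable_sum borel_measurable_inner borel_measurable_const measurable_noise)

lemma measurable_noise_energy:
  assumes "\<tau> \<in> segmentations n"
  shows "random_variable borel (noise_energy \<tau>)"
proof -
  have "noise i \<in> borel_measurable M" if "l \<in> {1..nsegs \<tau>}" "i \<in> segment \<tau> l" for i l
    using segment_subset[OF assms that(1)] that(2) by (intro measurable_noise) auto
  then show ?thesis
    unfolding noise_energy_def
    by (intro borel_measurable_sum borel_measurable_divide borel_measurable_power
        measurable_compose[OF _ borel_measurable_norm] borel_measurable_const)
qed

lemma quad_risk_eq:
  assumes \<tau>: "\<tau> \<in> segmentations n"
  shows "real n * quad_risk n mean_vec (seg_proj n \<tau> (\<lambda>i. Y i \<omega>)) = sq_bias \<tau> + noise_energy \<tau> \<omega>"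
proof -
  have "real n * quad_risk n mean_vec (seg_proj n \<tau> (\<lambda>i. Y i \<omega>))
      = (\<Sum>l=1..nsegs \<tau>. \<Sum>i\<in>segment \<tau> l. (norm (seg_proj n \<tau> (\<lambda>i. Y i \<omega>) i - mean_vec i))\<^sup>2)"
    using n_pos by (simp add: quad_risk_def sum_over_segments[OF \<tau>] del: One_nat_def)
  also have "\<dots> = (\<Sum>l=1..nsegs \<tau>. (\<Sum>i\<in>segment \<tau> l. (norm (bias \<tau> i))\<^sup>2)
      + (norm (\<Sum>i\<in>segment \<tau> l. noise i \<omega>))\<^sup>2 / real (card (segment \<tau> l)))"
  proof (rule sum.cong[OF refl])
    fix l assume l: "l \<in> {1..nsegs \<tau>}"
    show "(\<Sum>i\<in>segment \<tau> l. (norm (seg_proj n \<tau> (\<lambda>i. Y i \<omega>) i - mean_vec i))\<^sup>2)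
        = (\<Sum>i\<in>segment \<tau> l. (norm (bias \<tau> i))\<^sup>2)
          + (norm (\<Sum>i\<in>segment \<tau> l. noise i \<omega>))\<^sup>2 / real (card (segment \<tau> l))"
      using sum_sq_mean_on_error[OF _ segment_nonempty[OF \<tau> l], of "\<lambda>i. Y i \<omega>" mean_vec]
      by (simp add: seg_proj_eq_mean_on[OF \<tau> l] bias_def noise_def segment_def)
  qed
  also have "\<dots> = sq_bias \<tau> + noise_energy \<tau> \<omega>"
    by (simp add: sum.distrib sq_bias_def noise_energy_def sum_over_segments[OF \<tau>] del: One_nat_def)
  finally show ?thesis .
qed

lemma residual_eq:
  assumes \<tau>: "\<tau> \<in> segmentations n"
  shows "(\<Sum>i=1..n. Y i \<omega> \<bullet> Y i \<omega>) - (\<Sum>l=1..nsegs \<tau>. 1 / real (card (segment \<tau> l)) *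
           (\<Sum>i\<in>segment \<tau> l. \<Sum>j\<in>segment \<tau> l. Y i \<omega> \<bullet> Y j \<omega>))
    = (\<Sum>i=1..n. (norm (noise i \<omega>))\<^sup>2)
      + real n * quad_risk n mean_vec (seg_proj n \<tau> (\<lambda>i. Y i \<omega>))
      + 2 * bias_noise \<tau> \<omega> - 2 * noise_energy \<tau> \<omega>" (is "?lhs = _")
proof -
  have "?lhs = (\<Sum>l=1..nsegs \<tau>. (\<Sum>i\<in>segment \<tau> l. Y i \<omega> \<bullet> Y i \<omega>) - 1 / real (card (segment \<tau> l)) *
           (\<Sum>i\<in>segment \<tau> l. \<Sum>j\<in>segment \<tau> l. Y i \<omega> \<bullet> Y j \<omega>))"
    by (simp add: sum_over_segments[OF \<tau>] sum_subtractf del: One_nat_def)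
  also have "\<dots> = (\<Sum>l=1..nsegs \<tau>. (\<Sum>i\<in>segment \<tau> l. (norm (noise i \<omega>))\<^sup>2)
      + (\<Sum>i\<in>segment \<tau> l. (norm (seg_proj n \<tau> (\<lambda>i. Y i \<omega>) i - mean_vec i))\<^sup>2)
      + 2 * (\<Sum>i\<in>segment \<tau> l. bias \<tau> i \<bullet> noise i \<omega>)
      - 2 * ((norm (\<Sum>i\<in>segment \<tau> l. noise i \<omega>))\<^sup>2 / real (card (segment \<tau> l))))"
  proof (rule sum.cong[OF refl])
    fix l assume l: "l \<in> {1..nsegs \<tau>}"
    show "(\<Sum>i\<in>segment \<tau> l. Y i \<omega> \<bullet> Y i \<omega>) - 1 / real (card (segment \<tau> l)) *
           (\<Sum>i\<in>segment \<tau> l. \<Sum>j\<in>segment \<tau> l. Y i \<omega> \<bullet> Y j \<omega>)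
      = (\<Sum>i\<in>segment \<tau> l. (norm (noise i \<omega>))\<^sup>2)
      + (\<Sum>i\<in>segment \<tau> l. (norm (seg_proj n \<tau> (\<lambda>i. Y i \<omega>) i - mean_vec i))\<^sup>2)
      + 2 * (\<Sum>i\<in>segment \<tau> l. bias \<tau> i \<bullet> noise i \<omega>)
      - 2 * ((norm (\<Sum>i\<in>segment \<tau> l. noise i \<omega>))\<^sup>2 / real (card (segment \<tau> l)))"
      unfolding noise_def
      using sum_sq_mean_on_residual[OF _ segment_nonempty[OF \<tau> l], of "\<lambda>i. Y i \<omega>" mean_vec]
      by (simp add: seg_proj_eq_mean_on[OF \<tau> l] bias_def segment_def)
  qed
  also have "\<dots> = (\<Sum>i=1..n. (norm (noise i \<omega>))\<^sup>2)
      + real n * quad_risk n mean_vec (seg_proj n \<tau> (\<lambda>i. Y i \<omega>))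
      + 2 * bias_noise \<tau> \<omega> - 2 * noise_energy \<tau> \<omega>"
    using n_pos
    by (simp add: sum.distrib sum_subtractf sum_distrib_left bias_noise_def noise_energy_def
        quad_risk_def sum_over_segments[OF \<tau>] del: One_nat_def)
  finally show ?thesis .
qed

lemma prob_bias_noise_ge:
  assumes "c = 1 \<or> c = -1"
  shows "prob {\<omega>\<in>space M. sq_bias \<tau> / 3 + 6 * b\<^sup>2 * x \<le> 2 * (c * bias_noise \<tau> \<omega>)} \<le> exp (- x)"
proof -
  \<comment> \<open>At this rate the variance term of Hoeffding's bound is \<open>s * sq_bias \<tau> / 6\<close>, which becomes
      \<open>sq_bias \<tau> / 3\<close> after multiplication by \<open>2 / s = 6 * b\<^sup>2\<close>.\<close>
  define s where "s = 1 / (3 * b\<^sup>2)"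
  have [measurable]: "random_variable borel (bias_noise \<tau>)"
    by (rule measurable_bias_noise)
  have c: "c\<^sup>2 = 1"
    using assms by auto
  have "(\<integral>\<^sup>+\<omega>. ennreal (exp (s * c * bias_noise \<tau> \<omega>)) \<partial>M)
      \<le> ennreal (exp (b\<^sup>2 * (\<Sum>i=1..n. (norm ((s * c) *\<^sub>R bias \<tau> i))\<^sup>2) / 2))"
    using nn_integral_exp_sum_inner_noise_le[of "\<lambda>i. (s * c) *\<^sub>R bias \<tau> i"]
    by (simp add: bias_noise_def sum_distrib_left)
  also have "b\<^sup>2 * (\<Sum>i=1..n. (norm ((s * c) *\<^sub>R bias \<tau> i))\<^sup>2) / 2 = s * sq_bias \<tau> / 6"
  proof -
    have "b\<^sup>2 * s\<^sup>2 = s / 3"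
      using b_pos by (simp add: s_def power2_eq_square)
    then show ?thesis
      using c by (simp add: sq_bias_def power_mult_distrib mult.assoc[symmetric] flip: sum_distrib_left)
  qed
  finally have "prob {\<omega>\<in>space M. s * sq_bias \<tau> / 6 + x \<le> s * c * bias_noise \<tau> \<omega>} \<le> exp (- x)"
    by (intro prob_ge_le_exp_if_exp_moment) measurable
  moreover have "s * sq_bias \<tau> / 6 + x \<le> s * c * bias_noise \<tau> \<omega>
      \<longleftrightarrow> sq_bias \<tau> / 3 + 6 * b\<^sup>2 * x \<le> 2 * (c * bias_noise \<tau> \<omega>)" for \<omega>
  proof -
    have "sq_bias \<tau> / 3 + 6 * b\<^sup>2 * x = 6 * b\<^sup>2 * (s * sq_bias \<tau> / 6 + x)"
      and "2 * (c * bias_noise \<tau> \<omega>) = 6 * b\<^sup>2 * (s * c * bias_noise \<tau> \<omega>)"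
      using b_pos by (simp_all add: s_def distrib_left)
    then show ?thesis
      using b_pos by (simp only: mult_le_cancel_left_pos zero_less_mult_iff zero_less_power) (simp add: mult.assoc)
  qed
  ultimately show ?thesis by simp
qed

lemma prob_noise_energy_ge:
  assumes \<tau>: "\<tau> \<in> segmentations n"
  shows "prob {\<omega>\<in>space M. 4 * b\<^sup>2 * (2 * real (nsegs \<tau>) + x) \<le> noise_energy \<tau> \<omega>} \<le> exp (- x)"
proof -
  have [measurable]: "random_variable borel (noise_energy \<tau>)"
    using \<tau> by (rule measurable_noise_energy)
  have "(\<integral>\<^sup>+\<omega>. ennreal (exp (noise_energy \<tau> \<omega> / (4 * b\<^sup>2))) \<partial>M) \<le> ennreal (exp (2 * real (nsegs \<tau>)))"
    unfolding noise_energy_def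
    using nn_integral_exp_block_energy_le[OF _ _ disjoint_segment[OF \<tau>]]
      segment_subset[OF \<tau>] segment_nonempty[OF \<tau>] by simp
  then have "prob {\<omega>\<in>space M. 2 * real (nsegs \<tau>) + x \<le> noise_energy \<tau> \<omega> / (4 * b\<^sup>2)} \<le> exp (- x)"
    by (intro prob_ge_le_exp_if_exp_moment) measurable
  then show ?thesis
    using b_pos by (simp add: field_simps)
qed

text \<open>
  The level of \<open>\<tau>\<close> exceeds \<open>y\<close> by \<open>ln (n-1 choose D-1) + 2 * D\<close>, which pays for a union bound over
  all segmentations and the three tails.
\<close>

definition level :: "real \<Rightarrow> nat list \<Rightarrow> real" where
  "level y \<tau> = y + ln (real ((n - 1) choose (nsegs \<tau> - 1))) + 2 * real (nsegs \<tau>)"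

lemma uniform_deviation_event:
  obtains E where "E \<in> events" "1 - exp (- y) \<le> prob E"
    and "\<And>\<omega> \<tau>. \<omega> \<in> E \<Longrightarrow> \<tau> \<in> segmentations n \<Longrightarrow>
      2 * \<bar>bias_noise \<tau> \<omega>\<bar> \<le> sq_bias \<tau> / 3 + 6 * b\<^sup>2 * level y \<tau>"
    and "\<And>\<omega> \<tau>. \<omega> \<in> E \<Longrightarrow> \<tau> \<in> segmentations n \<Longrightarrow>
      noise_energy \<tau> \<omega> \<le> 4 * b\<^sup>2 * (2 * real (nsegs \<tau>) + level y \<tau>)"
proof -
  define L where "L c \<tau> = {\<omega>\<in>space M. sq_bias \<tau> / 3 + 6 * b\<^sup>2 * level y \<tau> \<le> 2 * (c * bias_noise \<tau> \<omega>)}"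
    for c \<tau>
  define Q where "Q \<tau> = {\<omega>\<in>space M. 4 * b\<^sup>2 * (2 * real (nsegs \<tau>) + level y \<tau>) \<le> noise_energy \<tau> \<omega>}" for \<tau>
  define bad where "bad \<tau> = L 1 \<tau> \<union> L (-1) \<tau> \<union> Q \<tau>" for \<tau>
  have L: "L c \<tau> \<in> events" for c \<tau>
    unfolding L_def using measurable_bias_noise[of \<tau>] by measurable
  have Q: "Q \<tau> \<in> events" if "\<tau> \<in> segmentations n" for \<tau>
    unfolding Q_def using measurable_noise_energy[OF that] by measurable
  have bad: "bad \<tau> \<in> events" if "\<tau> \<in> segmentations n" for \<tau>
    unfolding bad_def using L Q[OF that] by blast
  have prob_bad: "prob (bad \<tau>) \<le> 3 * exp (- level y \<tau>)" if \<tau>: "\<tau> \<in> segmentations n" for \<tau>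
  proof -
    have "prob (bad \<tau>) \<le> prob (L 1 \<tau>) + prob (L (-1) \<tau>) + prob (Q \<tau>)"
      using measure_Un_le[OF L L, of 1 \<tau> "-1" \<tau>] measure_Un_le[OF sets.Un[OF L L] Q[OF \<tau>], of 1 \<tau> "-1" \<tau>]
      unfolding bad_def by linarith
    also have "\<dots> \<le> exp (- level y \<tau>) + exp (- level y \<tau>) + exp (- level y \<tau>)"
      unfolding L_def Q_def
      by (intro add_mono prob_bias_noise_ge prob_noise_energy_ge \<tau>) auto
    finally show ?thesis by simp
  qed
  have bad_sub: "(\<Union>\<tau>\<in>segmentations n. bad \<tau>) \<in> events"
    using bad finite_segmentations by (intro sets.finite_UN) auto
  have "prob (\<Union>\<tau>\<in>segmentations n. bad \<tau>) \<le> (\<Sum>\<tau>\<in>segmentations n. prob (bad \<tau>))"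
    using bad finite_segmentations by (intro finite_measure_subadditive_finite) auto
  also have "\<dots> \<le> (\<Sum>\<tau>\<in>segmentations n. 3 * exp (- level y \<tau>))"
    by (intro sum_mono prob_bad)
  also have "\<dots> = 3 * exp (- y) *
      (\<Sum>\<tau>\<in>segmentations n. exp (- ln (real ((n - 1) choose (nsegs \<tau> - 1))) - 2 * real (nsegs \<tau>)))"
    by (simp add: level_def sum_distrib_left algebra_simps flip: exp_add)
  also have "\<dots> \<le> 3 * exp (- y) * (1 / 3)"
    by (intro mult_left_mono sum_segmentations_weight_le) simp
  finally have p: "prob (\<Union>\<tau>\<in>segmentations n. bad \<tau>) \<le> exp (- y)"
    by simp
  show ?thesis
  proof (rule that[of "space M - (\<Union>\<tau>\<in>segmentations n. bad \<tau>)"])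
    show "space M - (\<Union>\<tau>\<in>segmentations n. bad \<tau>) \<in> events"
      using bad_sub by blast
    show "1 - exp (- y) \<le> prob (space M - (\<Union>\<tau>\<in>segmentations n. bad \<tau>))"
      using p bad_sub by (simp add: prob_compl)
  next
    fix \<omega> \<tau> assume "\<omega> \<in> space M - (\<Union>\<tau>\<in>segmentations n. bad \<tau>)" "\<tau> \<in> segmentations n"
    then have "\<omega> \<notin> L 1 \<tau>" "\<omega> \<notin> L (-1) \<tau>" "\<omega> \<notin> Q \<tau>" "\<omega> \<in> space M"
      by (auto simp: bad_def)
    then show "2 * \<bar>bias_noise \<tau> \<omega>\<bar> \<le> sq_bias \<tau> / 3 + 6 * b\<^sup>2 * level y \<tau>"
      and "noise_energy \<tau> \<omega> \<le> 4 * b\<^sup>2 * (2 * real (nsegs \<tau>) + level y \<tau>)"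
      by (auto simp: L_def Q_def)
  qed
qed

text \<open>
  A third of the risk is spent on each of the two segmentations, whence the factor
  \<open>(1 + 1/3) / (1 - 1/3) = 2\<close>. For the minimizer, \<open>5/3\<close> of the noise energy and the bias term cost
  \<open>5/3 * 16 + 12 < 40\<close> times \<open>b\<^sup>2 * D\<close>, which is the constant required of the penalty.
\<close>

lemma oracle_inequality_on_deviation_event:
  fixes emp pen :: "nat list \<Rightarrow> real"
  assumes dev_lin: "\<And>\<tau>. \<tau> \<in> segmentations n \<Longrightarrow>
      2 * \<bar>bias_noise \<tau> \<omega>\<bar> \<le> sq_bias \<tau> / 3 + 6 * b\<^sup>2 * level y \<tau>"
    and dev_sq: "\<And>\<tau>. \<tau> \<in> segmentations n \<Longrightarrow>
      noise_energy \<tau> \<omega> \<le> 4 * b\<^sup>2 * (2 * real (nsegs \<tau>) + level y \<tau>)"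
    and emp: "\<And>\<tau>. \<tau> \<in> segmentations n \<Longrightarrow> real n * emp \<tau> = (\<Sum>i=1..n. (norm (noise i \<omega>))\<^sup>2)
      + real n * quad_risk n mean_vec (seg_proj n \<tau> (\<lambda>i. Y i \<omega>))
      + 2 * bias_noise \<tau> \<omega> - 2 * noise_energy \<tau> \<omega>"
    and pen: "\<And>\<tau>. \<tau> \<in> segmentations n \<Longrightarrow>
      40 * b\<^sup>2 * (ln (real ((n - 1) choose (nsegs \<tau> - 1))) + real (nsegs \<tau>)) \<le> real n * pen \<tau>"
    and \<sigma>: "\<sigma> \<in> segmentations n" and \<tau>: "\<tau> \<in> segmentations n"
    and min: "emp \<sigma> + pen \<sigma> \<le> emp \<tau> + pen \<tau>" and "0 \<le> y"
  shows "real n * quad_risk n mean_vec (seg_proj n \<sigma> (\<lambda>i. Y i \<omega>))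
    \<le> 2 * (real n * quad_risk n mean_vec (seg_proj n \<tau> (\<lambda>i. Y i \<omega>)) + real n * pen \<tau>) + 83 * (b\<^sup>2 * y)"
proof -
  define R where "R \<tau> = real n * quad_risk n mean_vec (seg_proj n \<tau> (\<lambda>i. Y i \<omega>))" for \<tau>
  define p where "p \<tau> = real n * pen \<tau>" for \<tau>
  define z where "z = b\<^sup>2 * y"
  \<comment> \<open>The products are named so that the remaining inequalities are linear in them.\<close>
  define l where "l \<tau> = b\<^sup>2 * ln (real ((n - 1) choose (nsegs \<tau> - 1)))" for \<tau>
  define d where "d \<tau> = b\<^sup>2 * real (nsegs \<tau>)" for \<tau>
  have nonneg: "0 \<le> l \<tau>" "0 \<le> d \<tau>" if "\<tau> \<in> segmentations n" for \<tau>
    using ln_choose_nsegs_nonneg[OF that] by (simp_all add: l_def d_def)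
  have lin: "6 * \<bar>bias_noise \<tau> \<omega>\<bar> \<le> sq_bias \<tau> + 18 * z + 18 * l \<tau> + 36 * d \<tau>"
    and sq: "noise_energy \<tau> \<omega> \<le> 4 * z + 4 * l \<tau> + 16 * d \<tau>"
    and pen': "40 * l \<tau> + 40 * d \<tau> \<le> p \<tau>" if "\<tau> \<in> segmentations n" for \<tau>
    using dev_lin[OF that] dev_sq[OF that] pen[OF that]
    by (simp_all add: level_def l_def d_def p_def z_def algebra_simps)
  have "real n * (emp \<sigma> + pen \<sigma>) \<le> real n * (emp \<tau> + pen \<tau>)"
    using min by (rule mult_left_mono) simp
  then have "R \<sigma> + 2 * bias_noise \<sigma> \<omega> - 2 * noise_energy \<sigma> \<omega> + p \<sigma>
      \<le> R \<tau> + 2 * bias_noise \<tau> \<omega> - 2 * noise_energy \<tau> \<omega> + p \<tau>"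
    using emp[OF \<sigma>] emp[OF \<tau>] by (simp add: distrib_left R_def p_def)
  moreover have "0 \<le> z"
    using \<open>0 \<le> y\<close> by (simp add: z_def)
  moreover have "6 * noise_energy \<sigma> \<omega> - 6 * bias_noise \<sigma> \<omega> \<le> R \<sigma> + 3 * p \<sigma> + 39 * z"
    using lin[OF \<sigma>] sq[OF \<sigma>] pen'[OF \<sigma>] nonneg[OF \<sigma>] \<open>0 \<le> z\<close> quad_risk_eq[OF \<sigma>, of \<omega>, folded R_def] by linarith
  moreover have "6 * bias_noise \<tau> \<omega> - 6 * noise_energy \<tau> \<omega> \<le> R \<tau> + p \<tau> + 18 * z"
    using lin[OF \<tau>] pen'[OF \<tau>] nonneg[OF \<tau>] quad_risk_eq[OF \<tau>, of \<omega>, folded R_def] noise_energy_nonneg[of \<tau> \<omega>]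
    by linarith
  ultimately have "2 * R \<sigma> \<le> 4 * R \<tau> + 4 * p \<tau> + 57 * z"
    by argo
  then have "R \<sigma> \<le> 2 * (R \<tau> + p \<tau>) + 83 * z"
    using \<open>0 \<le> z\<close> by argo
  then show ?thesis
    unfolding R_def p_def z_def .
qed

end

section \<open>The oracle inequality\<close>

theorem theorem2:
  "\<exists>L1::real. 0 < L1 \<and> L1 \<le> 1000 \<and>
    (\<forall>(n::nat) (P::'w measure) (S::'a measure) (X::nat \<Rightarrow> 'w \<Rightarrow> 'a) (k::'a \<Rightarrow> 'a \<Rightarrow> real)
       (eval_at::'h::{real_inner, banach, second_countable_topology} \<Rightarrow> 'a \<Rightarrow> real)
       (M::real) (C::real) (pen::nat list \<Rightarrow> real).
       n \<ge> 1 \<longrightarrow>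
       prob_space P \<longrightarrow>
       prob_space.indep_vars P (\<lambda>_. S) X {1..n} \<longrightarrow>
       psd_kernel S k \<longrightarrow>
       is_RKHS (space S) k eval_at \<longrightarrow>
       M > 0 \<longrightarrow>
       (\<forall>i\<in>{1..n}. AE \<omega> in P. k (X i \<omega>) (X i \<omega>) \<le> M\<^sup>2) \<longrightarrow>
       C \<ge> 0 \<longrightarrow>
       (\<forall>\<tau>\<in>segmentations n.
          pen \<tau> \<ge> C * M\<^sup>2 / real n *
            (ln (real ((n - 1) choose (nsegs \<tau> - 1))) + real (nsegs \<tau>))) \<longrightarrow>
       C \<ge> L1 \<longrightarrow>
       (let \<Phi> = feature_map (space S) k eval_at;
            Y = (\<lambda>\<omega> i. \<Phi> (X i \<omega>));
            \<mu>star = (\<lambda>i. \<integral>\<omega>. Y \<omega> i \<partial>P);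
            \<mu>hat = (\<lambda>\<tau> \<omega>. seg_proj n \<tau> (Y \<omega>))
        in \<forall>y\<ge>0. \<exists>E\<in>sets P. measure P E \<ge> 1 - exp (- y) \<and>
             (\<forall>\<omega>\<in>E. \<forall>\<tau>hat.
                is_arg_min (\<lambda>\<tau>. emp_risk k n (\<lambda>i. X i \<omega>) \<tau> + pen \<tau>)
                  (\<lambda>\<tau>. \<tau> \<in> segmentations n) \<tau>hat \<longrightarrow>
                quad_risk n \<mu>star (\<mu>hat \<tau>hat \<omega>) \<le>
                  2 * (INF \<tau>\<in>segmentations n. quad_risk n \<mu>star (\<mu>hat \<tau> \<omega>) + pen \<tau>)
                  + 83 * y * M\<^sup>2 / real n)))"
proof (rule exI[of _ 40], intro conjI allI impI)
  show "(0::real) < 40" "(40::real) \<le> 1000" by simp_all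
next
  fix n :: nat and P :: "'w measure" and S :: "'a measure" and X :: "nat \<Rightarrow> 'w \<Rightarrow> 'a"
    and k :: "'a \<Rightarrow> 'a \<Rightarrow> real"
    and eval_at :: "'h::{real_inner, banach, second_countable_topology} \<Rightarrow> 'a \<Rightarrow> real"
    and M C :: real and pen :: "nat list \<Rightarrow> real"
  assume n: "1 \<le> n" and P: "prob_space P"
    and indep: "prob_space.indep_vars P (\<lambda>_. S) X {1..n}"
    and psd: "psd_kernel S k" and rkhs: "is_RKHS (space S) k eval_at" and M: "0 < M"
    and bd: "\<forall>i\<in>{1..n}. AE \<omega> in P. k (X i \<omega>) (X i \<omega>) \<le> M\<^sup>2"
    and "0 \<le> C"
    and pen: "\<forall>\<tau>\<in>segmentations n. C * M\<^sup>2 / real n *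
        (ln (real ((n - 1) choose (nsegs \<tau> - 1))) + real (nsegs \<tau>)) \<le> pen \<tau>"
    and C: "40 \<le> C"
  interpret P: prob_space P by (rule P)
  define \<Phi> where "\<Phi> = feature_map (space S) k eval_at"
  define Y where "Y = (\<lambda>i \<omega>. \<Phi> (X i \<omega>))"
  define R where "R = (\<lambda>\<tau> \<omega>. quad_risk n (\<lambda>i. \<integral>\<omega>. Y i \<omega> \<partial>P) (seg_proj n \<tau> (\<lambda>i. Y i \<omega>)))"
  have X: "X i \<in> measurable P S" if "i \<in> {1..n}" for i
    using indep that by (simp add: P.indep_vars_def)
  have kernel: "k (X i \<omega>) (X j \<omega>) = Y i \<omega> \<bullet> Y j \<omega>" if "\<omega> \<in> space P" "i \<in> {1..n}" "j \<in> {1..n}" for i j \<omega>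
    using measurable_space[OF X[OF that(2)] that(1)] measurable_space[OF X[OF that(3)] that(1)]
    by (simp add: Y_def \<Phi>_def inner_feature_map[OF rkhs])
  interpret segmented_sample P Y n M
  proof
    show "P.indep_vars (\<lambda>_. borel) Y {1..n}"
      unfolding Y_def \<Phi>_def using measurable_feature_map[OF psd rkhs]
      by (intro P.indep_vars_compose2[OF indep])
    show "AE \<omega> in P. norm (Y i \<omega>) \<le> M" if i: "i \<in> {1..n}" for i
      using bspec[OF bd i] AE_space
    proof eventually_elim
      case (elim \<omega>)
      then have "(norm (Y i \<omega>))\<^sup>2 \<le> M\<^sup>2"
        using kernel[of \<omega> i i] i by (simp add: power2_norm_eq_inner)
      then show ?case
        by (rule power2_le_imp_le) (rule less_imp_le[OF M])
    qed
  qed (simp_all only: n M finite_atLeastAtMost)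
  \<comment> \<open>This holds on all of \<open>space P\<close>: the almost sure bound on the kernel is not needed here.\<close>
  have emp: "real n * emp_risk k n (\<lambda>i. X i \<omega>) \<tau> = (\<Sum>i=1..n. (norm (noise i \<omega>))\<^sup>2) + real n * R \<tau> \<omega>
      + 2 * bias_noise \<tau> \<omega> - 2 * noise_energy \<tau> \<omega>" if \<omega>: "\<omega> \<in> space P" and \<tau>: "\<tau> \<in> segmentations n" for \<omega> \<tau>
  proof -
    have seg: "(\<Sum>i\<in>segment \<tau> l. \<Sum>j\<in>segment \<tau> l. k (X i \<omega>) (X j \<omega>))
        = (\<Sum>i\<in>segment \<tau> l. \<Sum>j\<in>segment \<tau> l. Y i \<omega> \<bullet> Y j \<omega>)"
      and len: "real (\<tau> ! l) - real (\<tau> ! (l - 1)) = real (card (segment \<tau> l))"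
      if l: "l \<in> {1..nsegs \<tau>}" for l
    proof -
      show "(\<Sum>i\<in>segment \<tau> l. \<Sum>j\<in>segment \<tau> l. k (X i \<omega>) (X j \<omega>))
          = (\<Sum>i\<in>segment \<tau> l. \<Sum>j\<in>segment \<tau> l. Y i \<omega> \<bullet> Y j \<omega>)"
        using segment_subset[OF \<tau> l] by (intro sum.cong refl kernel \<omega>) auto
      have "\<tau> ! (l - 1) \<le> \<tau> ! l"
        using segment_nonempty[OF \<tau> l] by (auto simp: segment_def)
      then show "real (\<tau> ! l) - real (\<tau> ! (l - 1)) = real (card (segment \<tau> l))"
        by (simp add: card_segment of_nat_diff)
    qed
    have "real n * emp_risk k n (\<lambda>i. X i \<omega>) \<tau> = (\<Sum>i=1..n. k (X i \<omega>) (X i \<omega>))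
        - (\<Sum>l=1..nsegs \<tau>. 1 / (real (\<tau> ! l) - real (\<tau> ! (l - 1))) *
            (\<Sum>i\<in>segment \<tau> l. \<Sum>j\<in>segment \<tau> l. k (X i \<omega>) (X j \<omega>)))"
      using n by (simp add: emp_risk_def right_diff_distrib)
    also have "\<dots> = (\<Sum>i=1..n. Y i \<omega> \<bullet> Y i \<omega>) - (\<Sum>l=1..nsegs \<tau>. 1 / real (card (segment \<tau> l)) *
           (\<Sum>i\<in>segment \<tau> l. \<Sum>j\<in>segment \<tau> l. Y i \<omega> \<bullet> Y j \<omega>))"
      by (intro arg_cong2[where f = minus] sum.cong refl kernel \<omega> arg_cong2[where f = times]
          arg_cong2[where f = divide] seg len)
    finally show ?thesis
      unfolding residual_eq[OF \<tau>] R_def .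
  qed
  have pen': "40 * M\<^sup>2 * (ln (real ((n - 1) choose (nsegs \<tau> - 1))) + real (nsegs \<tau>)) \<le> real n * pen \<tau>"
    if \<tau>: "\<tau> \<in> segmentations n" for \<tau>
  proof -
    let ?w = "ln (real ((n - 1) choose (nsegs \<tau> - 1))) + real (nsegs \<tau>)"
    have "0 \<le> M\<^sup>2 * ?w"
      using ln_choose_nsegs_nonneg[OF \<tau>] by simp
    then have "40 * (M\<^sup>2 * ?w) \<le> C * (M\<^sup>2 * ?w)"
      using C by (rule mult_right_mono[rotated])
    also have "\<dots> = real n * (C * M\<^sup>2 / real n * ?w)"
      using n by simp
    also have "\<dots> \<le> real n * pen \<tau>"
      using pen \<tau> by (intro mult_left_mono) auto
    finally show ?thesis by (simp add: mult.assoc)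
  qed
  have "\<exists>E\<in>sets P. 1 - exp (- y) \<le> measure P E \<and>
      (\<forall>\<omega>\<in>E. \<forall>\<sigma>. is_arg_min (\<lambda>\<tau>. emp_risk k n (\<lambda>i. X i \<omega>) \<tau> + pen \<tau>) (\<lambda>\<tau>. \<tau> \<in> segmentations n) \<sigma> \<longrightarrow>
        R \<sigma> \<omega> \<le> 2 * (INF \<tau>\<in>segmentations n. R \<tau> \<omega> + pen \<tau>) + 83 * y * M\<^sup>2 / real n)" if y: "0 \<le> y" for y
  proof -
    obtain E where E: "E \<in> sets P" "1 - exp (- y) \<le> P.prob E"
      and lin: "\<And>\<omega> \<tau>. \<omega> \<in> E \<Longrightarrow> \<tau> \<in> segmentations n \<Longrightarrow>
        2 * \<bar>bias_noise \<tau> \<omega>\<bar> \<le> sq_bias \<tau> / 3 + 6 * M\<^sup>2 * level y \<tau>"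
      and sq: "\<And>\<omega> \<tau>. \<omega> \<in> E \<Longrightarrow> \<tau> \<in> segmentations n \<Longrightarrow>
        noise_energy \<tau> \<omega> \<le> 4 * M\<^sup>2 * (2 * real (nsegs \<tau>) + level y \<tau>)"
      using uniform_deviation_event[of y] by blast
    show ?thesis
    proof (intro bexI[OF _ E(1)] conjI ballI allI impI E(2))
      fix \<omega> \<sigma> assume \<omega>: "\<omega> \<in> E"
        and min: "is_arg_min (\<lambda>\<tau>. emp_risk k n (\<lambda>i. X i \<omega>) \<tau> + pen \<tau>) (\<lambda>\<tau>. \<tau> \<in> segmentations n) \<sigma>"
      then have \<sigma>: "\<sigma> \<in> segmentations n" and \<omega>': "\<omega> \<in> space P"
        using E(1) sets.sets_into_space by (auto simp: is_arg_min_def)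
      have "(R \<sigma> \<omega> - 83 * y * M\<^sup>2 / real n) / 2 \<le> (INF \<tau>\<in>segmentations n. R \<tau> \<omega> + pen \<tau>)"
      proof (rule cINF_greatest)
        show "segmentations n \<noteq> {}"
          using n by (rule segmentations_nonempty)
        fix \<tau> assume \<tau>: "\<tau> \<in> segmentations n"
        have le: "emp_risk k n (\<lambda>i. X i \<omega>) \<sigma> + pen \<sigma> \<le> emp_risk k n (\<lambda>i. X i \<omega>) \<tau> + pen \<tau>"
          using min \<tau> by (auto simp: is_arg_min_def not_less)
        have "real n * R \<sigma> \<omega> \<le> 2 * (real n * R \<tau> \<omega> + real n * pen \<tau>) + 83 * (M\<^sup>2 * y)"
          unfolding R_def
          by (rule oracle_inequality_on_deviation_event[OF lin[OF \<omega>] sq[OF \<omega>] emp[OF \<omega>', unfolded R_def]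
                pen' \<sigma> \<tau> le y])
        then show "(R \<sigma> \<omega> - 83 * y * M\<^sup>2 / real n) / 2 \<le> R \<tau> \<omega> + pen \<tau>"
          using n by (simp add: field_simps)
      qed
      then show "R \<sigma> \<omega> \<le> 2 * (INF \<tau>\<in>segmentations n. R \<tau> \<omega> + pen \<tau>) + 83 * y * M\<^sup>2 / real n"
        by (simp add: field_simps)
    qed
  qed
  then show "let \<Phi> = feature_map (space S) k eval_at;
            Y = (\<lambda>\<omega> i. \<Phi> (X i \<omega>));
            \<mu>star = (\<lambda>i. \<integral>\<omega>. Y \<omega> i \<partial>P);
            \<mu>hat = (\<lambda>\<tau> \<omega>. seg_proj n \<tau> (Y \<omega>))
        in \<forall>y\<ge>0. \<exists>E\<in>sets P. measure P E \<ge> 1 - exp (- y) \<and>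
             (\<forall>\<omega>\<in>E. \<forall>\<tau>hat.
                is_arg_min (\<lambda>\<tau>. emp_risk k n (\<lambda>i. X i \<omega>) \<tau> + pen \<tau>)
                  (\<lambda>\<tau>. \<tau> \<in> segmentations n) \<tau>hat \<longrightarrow>
                quad_risk n \<mu>star (\<mu>hat \<tau>hat \<omega>) \<le>
                  2 * (INF \<tau>\<in>segmentations n. quad_risk n \<mu>star (\<mu>hat \<tau> \<omega>) + pen \<tau>)
                  + 83 * y * M\<^sup>2 / real n)"
    unfolding Let_def R_def Y_def \<Phi>_def by blast
qed

end
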